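(* The $\mathsf{UORA}$ policy (with parameters $\epsilon,\nu_{\max},w,V,Q,(\theta_c)$ chosen as specified in the context) yields limiting utility satisfying $$\sum_{c}g_c(\overline{r_c})\ \ge\ \sum_c g_c(r_c^* )-\frac{B_1}{V}-\frac{3\epsilon}{2}\sum_c(m_c+\theta_c),$$ where $$\overline{r_c}\triangleq\lim_{t\to\infty}\frac1t\sum_{\tau=0}^{t-1}\mathbb E\Big[\sum_{a:(a,d_c)\in\mathcal L}\widetilde\mu_{ad_c}^{(c)}(\tau)\Big]$$ ($\widetilde\mu_{ad_c}^{(c)}(\tau)$ being the class $c$ packets received by $d_c$ over link $(a,d_c)$ in slot $\tau$), $(r_c^* )$ is the throughput vector solving the utility maximization problem $\max\{\sum_c g_c(r_c):(r_c)\in\Lambda_{\boldsymbol\lambda}\}$, and $B_1$ is the finite constant $$\begin{aligned}B_1\triangleq{}&|\mathcal N||\mathcal C|\left[(\mu_{\max}^{\text{out}}+d_{\max})^2+(A_{\max}+\mu_{\max}^{\text{in}})^2+2d_{\max}^2\right]\\&+|\mathcal C|\Big[w(2\delta_{\max}+\epsilon)+e^{w(\nu_{\max}+\mu_{\max}^{\text{in}})}+\frac{w\epsilon}{2}e^{wQ}+e^{wQ}\Big].\end{aligned}$$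
   Context: Network model. Finite node set $\mathcal N=\{1,\dots,N\}$, set $\mathcal L$ of directed links, finite set $\mathcal C$ of traffic classes; class $c$ has destination $d_c\in\mathcal N$. Time is slotted, $t=0,1,2,\dots$. Exogenous class $c$ arrivals at node $n$ in slot $t$: $A_n^{(c)}(t)\in\{0,\dots,A_{\max}\}$, with $A_{d_c}^{(c)}(t)=0$; they are independent across $c$ and $n\ne d_c$ and i.i.d. over slots with mean $\lambda_n^{(c)}$; $\boldsymbol\lambda=(\lambda_n^{(c)})$. Link $(n,m)$ has capacity $\mu_{\max}^{nm}$; a policy allocates service rates $\mu_{nm}^{(c)}(t)\ge0$ with $\sum_c\mu_{nm}^{(c)}(t)\le\mu_{\max}^{nm}$. $\mathcal C_l$ denotes the set of classes having access to link $l$; service rates $\mu_l^{(c)}(t)$ and flow variables $f_l^{(c)}$ are zero for $c\notin\mathcal C_l$, and class $c$ has no access to links leaving $d_c$ (packets leave the network at $d_c$). $Q_n^{(c)}(t)$ is the class $c$ backlog at node $n\ne d_c$, $Q_n^{(c)}(0)=0$. After transmission in a slot, the queue allocates a drop rate $d_n^{(c)}(t)\in[0,d_{\max}]$; the packets actually dropped are $$\widetilde d_n^{(c)}(t)=\min\Big[\big(Q_n^{(c)}(t)-\sum_b\mu_{nb}^{(c)}(t)\big)^+,\,d_n^{(c)}(t)\Big],\qquad (x)^+=\max(x,0).$$ Let $\widetilde\mu_{nb}^{(c)}(t)$ be the class $c$ packets actually sent over $(n,b)$: $0\le\widetilde\mu_{nb}^{(c)}(t)\le\mu_{nb}^{(c)}(t)$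 and $\sum_b\widetilde\mu_{nb}^{(c)}(t)=\min[Q_n^{(c)}(t),\sum_b\mu_{nb}^{(c)}(t)]$. Then $$Q_n^{(c)}(t+1)=Q_n^{(c)}(t)-\sum_b\widetilde\mu_{nb}^{(c)}(t)-\widetilde d_n^{(c)}(t)+A_n^{(c)}(t)+\sum_a\widetilde\mu_{an}^{(c)}(t),$$ so that $Q_n^{(c)}(t+1)\le\big[(Q_n^{(c)}(t)-\sum_b\mu_{nb}^{(c)}(t))^+-d_n^{(c)}(t)\big]^++A_n^{(c)}(t)+\sum_a\mu_{an}^{(c)}(t)$. Constants: $\mu_{\max}^{\text{in}}=\max_{n}\sum_{a:(a,n)\in\mathcal L}\mu_{\max}^{an}$, $\mu_{\max}^{\text{out}}=\max_n\sum_{b:(n,b)\in\mathcal L}\mu_{\max}^{nb}$. Standing assumption: $d_{\max}\ge A_{\max}+\mu_{\max}^{\text{in}}$ ($d_{\max}$ finite). Sums over $n$ of class $c$ quantities are over $n\ne d_c$. Data amounts are nonnegative reals. Drop queues: for each $c$ and $n\ne d_c$, $D_n^{(c)}(0)=V\theta_c$ and $D_n^{(c)}(t+1)=[D_n^{(c)}(t)-\varphi_n^{(c)}(t)]^++\widetilde d_n^{(c)}(t)$, with $\varphi_n^{(c)}(t)\in[0,d_{\max}]$. Virtual queues: for each $c$, $Z_c(0)=0$ and $Z_c(t+1)=[Z_c(t)-\nu_c(t)]^++\sum_a\widetilde\mu_{ad_c}^{(c)}(t)$. Utilities. Each $g_c:[0,\infty)\to\mathbb R$ is concave, increasing, continuously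 differentiable, with $|g_c'(x)|\le m_c$ for all $x\ge0$, $m_c$ finite. Set $h_c(x)=g_c(x)-\theta_c x$. Throughput region. $\Lambda_{\boldsymbol\lambda}$ is the set of nonnegative vectors $(r_c)$ for which there exist $f_{ab}^{(c)}\ge0$, $q_n^{(c)}\ge0$ with $\lambda_n^{(c)}+\sum_af_{an}^{(c)}=q_n^{(c)}+\sum_bf_{nb}^{(c)}$ for all $c$, $n\ne d_c$; $\sum_cf_{ab}^{(c)}\le\mu_{\max}^{ab}$ for all $(a,b)\in\mathcal L$; and $r_c\le\sum_af_{ad_c}^{(c)}=\sum_n\lambda_n^{(c)}-\sum_nq_n^{(c)}$ for all $c$. Parameters. $\epsilon>0$; $\nu_{\max}\ge\max_cr_c^*+\epsilon/2$; $\delta_{\max}=\max[\nu_{\max},\mu_{\max}^{\text{in}}]$; $w=\frac{\epsilon}{\delta_{\max}^2}e^{-\epsilon/\delta_{\max}}$; $Q\ge\nu_{\max}$; $\theta_c>0$ such that $h_c'(x)=g_c'(x)-\theta_c\le0$ for all $x\ge\epsilon$; $V>0$ such that $V\theta_c+2d_{\max}\ge w$ for all $c$. $\mathsf{UORA}$ policy, in every slot $t$. For each class $c$ define $$Q_{d_c}^{(c)}(t)=\begin{cases}w\,e^{w(Z_c(t)-Q)}&\text{if }Z_c(t)\ge Q,\\-w\,e^{w(Q-Z_c(t))}&\text{if }Z_c(t)<Q\end{cases}$$ (a function of the virtual queue, not real data). (1) Packet dropping: $d_n^{(c)}(t)=d_{\max}$ if $Q_n^{(c)}(t)>D_n^{(c)}(t)$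 and $0$ otherwise; $\varphi_n^{(c)}(t)=d_{\max}$ if $D_n^{(c)}(t)>V\theta_c$ and $0$ otherwise. (2) Backpressure routing: for each link $l=(n,m)$, compute $W_l^{(c)}(t)=Q_n^{(c)}(t)-Q_m^{(c)}(t)$ for $c\in\mathcal C_l$ (where, when $m=d_c$, $Q_m^{(c)}(t)=Q_{d_c}^{(c)}(t)$ equals $w\,e^{w(Z_c(t)-Q)}$ if $Z_c(t)\ge Q$ and $-w\,e^{w(Q-Z_c(t))}$ if $Z_c(t)<Q$), and let $c_l^*(t)$ maximize $W_l^{(c)}(t)$ over $c\in\mathcal C_l$ (ties arbitrary). Set $\mu_{nm}^{(c_l^*(t))}(t)=\mu_{\max}^{nm}$ if $\max_{c\in\mathcal C_l}W_l^{(c)}(t)>0$ and $0$ otherwise; set $\mu_{nm}^{(c)}(t)=0$ for all other classes. (3) Receiver-based flow control: $\nu_c(t)$ is a maximizer of $Vh_c(\nu)+\nu\,Q_{d_c}^{(c)}(t)$ over $0\le\nu\le\nu_{\max}$. (4) Queue update: for each $c$ and $n\ne d_c$, set $Q_n^{(c)}(t+1)=Q_n^{(c)}(t)-\sum_b\widetilde\mu_{nb}^{(c)}(t)-\widetilde d_n^{(c)}(t)+A_n^{(c)}(t)+\sum_a\widetilde\mu_{an}^{(c)}(t)$ and $D_n^{(c)}(t+1)=[D_n^{(c)}(t)-\varphi_n^{(c)}(t)]^++\widetilde d_n^{(c)}(t)$; for each $c$, set $Z_c(t+1)=[Z_c(t)-\nu_c(t)]^++\sum_a\widetilde\mu_{ad_c}^{(c)}(t)$.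 The limits defining $\overline{r_c}$ are presumed to exist. *)

theory Defs
  imports "HOL-Probability.Probability"
begin

text \<open>Nodes and traffic classes are the elements of two finite types. A link is an ordered pair
  of nodes, and \<open>access G l\<close> is the set of classes having access to link \<open>l\<close>.\<close>

record ('n, 'c) network =
  links :: "('n \<times> 'n) set"
  dest :: "'c \<Rightarrow> 'n"
  access :: "'n \<times> 'n \<Rightarrow> 'c set"
  cap :: "'n \<times> 'n \<Rightarrow> real"

definition valid_network :: "('n, 'c) network \<Rightarrow> bool" where
  "valid_network G \<longleftrightarrow>
     (\<forall>l\<in>links G. 0 \<le> cap G l) \<and> (\<forall>c b. (dest G c, b) \<in> links G \<longrightarrow> c \<notin> access G (dest G c, b))"

definition inflow :: "('n, 'c) network \<Rightarrow> ('n \<times> 'n \<Rightarrow> real) \<Rightarrow> 'n \<Rightarrow> real" where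
  "inflow G x n = (\<Sum>a | (a, n) \<in> links G. x (a, n))"

definition outflow :: "('n, 'c) network \<Rightarrow> ('n \<times> 'n \<Rightarrow> real) \<Rightarrow> 'n \<Rightarrow> real" where
  "outflow G x n = (\<Sum>b | (n, b) \<in> links G. x (n, b))"

definition mu_in_max :: "('n::finite, 'c) network \<Rightarrow> real" where
  "mu_in_max G = (MAX n. inflow G (cap G) n)"

definition mu_out_max :: "('n::finite, 'c) network \<Rightarrow> real" where
  "mu_out_max G = (MAX n. outflow G (cap G) n)"

definition throughput_region ::
    "('n::finite, 'c::finite) network \<Rightarrow> ('c \<Rightarrow> 'n \<Rightarrow> real) \<Rightarrow> ('c \<Rightarrow> real) set" where
  "throughput_region G lam = {r. (\<forall>c. 0 \<le> r c) \<and>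
     (\<exists>f q.
        (\<forall>c. \<forall>l\<in>links G. 0 \<le> f c l \<and> (c \<notin> access G l \<longrightarrow> f c l = 0)) \<and>
        (\<forall>c n. n \<noteq> dest G c \<longrightarrow> 0 \<le> q c n) \<and>
        (\<forall>c n. n \<noteq> dest G c \<longrightarrow> lam c n + inflow G (f c) n = q c n + outflow G (f c) n) \<and>
        (\<forall>l\<in>links G. (\<Sum>c\<in>UNIV. f c l) \<le> cap G l) \<and>
        (\<forall>c. r c \<le> inflow G (f c) (dest G c) \<and>
             inflow G (f c) (dest G c)
               = (\<Sum>n | n \<noteq> dest G c. lam c n) - (\<Sum>n | n \<noteq> dest G c. q c n)))}"

text \<open>The value assigned to \<open>Q_{d_c}^{(c)}\<close> when the virtual queue of class \<open>c\<close> has backlog \<open>z\<close>;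
  \<open>Q0\<close> is the threshold parameter \<open>Q\<close> of the policy.\<close>

definition dest_backlog :: "real \<Rightarrow> real \<Rightarrow> real \<Rightarrow> real" where
  "dest_backlog w Q0 z = (if z \<ge> Q0 then w * exp (w * (z - Q0)) else - w * exp (w * (Q0 - z)))"

definition ext_backlog ::
    "('n, 'c) network \<Rightarrow> real \<Rightarrow> real \<Rightarrow> ('c \<Rightarrow> 'n \<Rightarrow> real) \<Rightarrow> ('c \<Rightarrow> real) \<Rightarrow> 'c \<Rightarrow> 'n \<Rightarrow> real" where
  "ext_backlog G w Q0 q z c n = (if n = dest G c then dest_backlog w Q0 (z c) else q c n)"

definition diff_backlog ::
    "('n, 'c) network \<Rightarrow> real \<Rightarrow> real \<Rightarrow> ('c \<Rightarrow> 'n \<Rightarrow> real) \<Rightarrow> ('c \<Rightarrow> real) \<Rightarrow> 'n \<times> 'n \<Rightarrow> 'c \<Rightarrow> real" where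
  "diff_backlog G w Q0 q z l c = ext_backlog G w Q0 q z c (fst l) - ext_backlog G w Q0 q z c (snd l)"

text \<open>Service rates \<open>x\<close> that may be allocated by backpressure when the link weights are \<open>W\<close>;
  \<open>k\<close> is the selected class, so ties are broken arbitrarily.\<close>

definition backpressure ::
    "('n, 'c) network \<Rightarrow> ('n \<times> 'n \<Rightarrow> 'c \<Rightarrow> real) \<Rightarrow> ('c \<Rightarrow> 'n \<times> 'n \<Rightarrow> real) \<Rightarrow> bool" where
  "backpressure G W x \<longleftrightarrow>
     (\<forall>l\<in>links G.
        (access G l = {} \<longrightarrow> (\<forall>c. x c l = 0)) \<and>
        (access G l \<noteq> {} \<longrightarrow>
           (\<exists>k. is_arg_max (W l) (\<lambda>c. c \<in> access G l) k \<and>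
                (\<forall>c. x c l = (if c = k \<and> W l k > 0 then cap G l else 0)))))"

end

theory Submission
  imports Defs
begin

text \<open>The proof is a drift-plus-penalty argument. The Lyapunov function is the sum of
  \<open>(Q\<^sup>2 + D\<^sup>2) / 2\<close> over all real queues and drop queues and of \<open>exp (w * \<bar>Z - Q0\<bar>)\<close> over all virtual
  queues; the artificial backlog \<open>dest_backlog\<close> of a destination is the derivative of the latter
  potential. To first order, one slot changes the Lyapunov function by a sum of products of backlogs
  and control decisions. With the penalty \<open>V * (\<theta> * \<phi> - (g \<nu> - \<theta> * \<nu>))\<close> added, this sum splits into a
  routing, a dropping, a drop-queue and an admission part, and each rule of the policy minimizes its
  part. So the policy does at least as well as a hypothetical stationary one which routes along an
  optimal flow, drops what that flow rejects and admits \<open>rstar + \<epsilon> / 2\<close> (\<open>slot_drift\<close>). For the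
  stationary policy all products cancel, apart from the mean-zero fluctuation of the arrivals. The
  second-order errors are covered by the constant \<open>B1\<close>, and the weight \<open>w\<close> is chosen such that the curvature of
  the exponential potential costs no more than an admission surplus of \<open>\<epsilon> / 2\<close>
  (\<open>exp_potential_drift\<close>).

  All queues are bounded uniformly in time (\<open>D_bounds\<close>, \<open>Q_le\<close>, \<open>Z_le\<close>), so summing over a long horizon
  bounds the time average of the penalty, and no queue retains a positive fraction of its input in the
  limit. Thus \<open>\<phi>\<close> is on average at least the rate of actual drops, which is the arrival rate minus the
  throughput (\<open>dropped_or_delivered\<close>), and \<open>\<nu>\<close> is on average at least the throughput
  (\<open>delivered_le_admitted\<close>). Because \<open>g x - \<theta> * x\<close> is nonincreasing beyond \<open>\<epsilon>\<close>, the surplus of \<open>\<nu>\<close> over the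
  throughput yields at most \<open>\<epsilon> * m\<close> (\<open>admission_gap\<close>).

  All this holds on every sample path (\<open>pathwise_utility_bound\<close>). Concavity is exploited through the
  tangents of the utilities at \<open>rbar\<close>, which keeps the bound affine in the delivered data. In the
  expectation the fluctuations of the arrivals disappear, since the backlogs at the beginning of a slot
  are independent of the arrivals during the slot, and the time average tends to the claim.\<close>

section \<open>Flows on links\<close>

lemma sum_inflow:
  fixes G :: "('n::finite, 'c) network"
  shows "(\<Sum>n\<in>UNIV. P n * inflow G x n) = (\<Sum>l\<in>links G. P (snd l) * x l)"
proof -
  have "(\<Sum>l\<in>links G. P (snd l) * x l)
      = (\<Sum>n\<in>UNIV. \<Sum>l\<in>{l \<in> links G. snd l = n}. P (snd l) * x l)"
    by (rule sum.group[symmetric]) auto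
  also have "\<dots> = (\<Sum>n\<in>UNIV. P n * inflow G x n)"
  proof (rule sum.cong[OF refl])
    fix n
    have "(\<Sum>l\<in>{l \<in> links G. snd l = n}. P (snd l) * x l)
        = (\<Sum>a | (a, n) \<in> links G. P n * x (a, n))"
      by (rule sum.reindex_bij_witness[where i = "\<lambda>a. (a, n)" and j = fst]) auto
    then show "(\<Sum>l\<in>{l \<in> links G. snd l = n}. P (snd l) * x l) = P n * inflow G x n"
      by (simp add: inflow_def sum_distrib_left)
  qed
  finally show ?thesis ..
qed

lemma sum_outflow:
  fixes G :: "('n::finite, 'c) network"
  shows "(\<Sum>n\<in>UNIV. P n * outflow G x n) = (\<Sum>l\<in>links G. P (fst l) * x l)"
proof -
  have "(\<Sum>l\<in>links G. P (fst l) * x l)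
      = (\<Sum>n\<in>UNIV. \<Sum>l\<in>{l \<in> links G. fst l = n}. P (fst l) * x l)"
    by (rule sum.group[symmetric]) auto
  also have "\<dots> = (\<Sum>n\<in>UNIV. P n * outflow G x n)"
  proof (rule sum.cong[OF refl])
    fix n
    have "(\<Sum>l\<in>{l \<in> links G. fst l = n}. P (fst l) * x l)
        = (\<Sum>b | (n, b) \<in> links G. P n * x (n, b))"
      by (rule sum.reindex_bij_witness[where i = "\<lambda>b. (n, b)" and j = snd]) auto
    then show "(\<Sum>l\<in>{l \<in> links G. fst l = n}. P (fst l) * x l) = P n * outflow G x n"
      by (simp add: outflow_def sum_distrib_left)
  qed
  finally show ?thesis ..
qed

lemma inflow_mono: "(\<And>l. l \<in> links G \<Longrightarrow> x l \<le> y l) \<Longrightarrow> inflow G x n \<le> inflow G y n"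
  unfolding inflow_def by (intro sum_mono) auto

lemma outflow_mono: "(\<And>l. l \<in> links G \<Longrightarrow> x l \<le> y l) \<Longrightarrow> outflow G x n \<le> outflow G y n"
  unfolding outflow_def by (intro sum_mono) auto

lemma inflow_nonneg: "(\<And>l. l \<in> links G \<Longrightarrow> 0 \<le> x l) \<Longrightarrow> 0 \<le> inflow G x n"
  unfolding inflow_def by (intro sum_nonneg) auto

lemma outflow_nonneg: "(\<And>l. l \<in> links G \<Longrightarrow> 0 \<le> x l) \<Longrightarrow> 0 \<le> outflow G x n"
  unfolding outflow_def by (intro sum_nonneg) auto

lemma inflow_scale: "inflow G (\<lambda>l. a * x l) n = a * inflow G x n"
  by (simp add: inflow_def sum_distrib_left)

lemma outflow_scale: "outflow G (\<lambda>l. a * x l) n = a * outflow G x n"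
  by (simp add: outflow_def sum_distrib_left)

lemma inflow_le_mu_in_max:
  fixes G :: "('n::finite, 'c) network"
  assumes "\<And>l. l \<in> links G \<Longrightarrow> x l \<le> cap G l"
  shows "inflow G x n \<le> mu_in_max G"
proof -
  have "inflow G x n \<le> inflow G (cap G) n"
    by (rule inflow_mono) (rule assms)
  also have "\<dots> \<le> mu_in_max G"
    unfolding mu_in_max_def by (rule Max_ge) auto
  finally show ?thesis .
qed

lemma outflow_le_mu_out_max:
  fixes G :: "('n::finite, 'c) network"
  assumes "\<And>l. l \<in> links G \<Longrightarrow> x l \<le> cap G l"
  shows "outflow G x n \<le> mu_out_max G"
proof -
  have "outflow G x n \<le> outflow G (cap G) n"
    by (rule outflow_mono) (rule assms)
  also have "\<dots> \<le> mu_out_max G"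
    unfolding mu_out_max_def by (rule Max_ge) auto
  finally show ?thesis .
qed

lemma outflow_dest:
  assumes "valid_network G" "\<And>l. l \<in> links G \<Longrightarrow> c \<notin> access G l \<Longrightarrow> x l = 0"
  shows "outflow G x (dest G c) = 0"
  unfolding outflow_def using assms by (intro sum.neutral) (auto simp: valid_network_def)

lemma sum_not_dest:
  fixes f :: "'n::finite \<Rightarrow> real"
  shows "(\<Sum>n\<in>UNIV. f n) = f k + (\<Sum>n | n \<noteq> k. f n)"
proof -
  have "UNIV - {k} = {n. n \<noteq> k}"
    by auto
  then show ?thesis
    using sum.remove[of UNIV k f] by simp
qed

text \<open>Summation by parts: the backlog of a node is collected once for each link leaving it and
  once, negatively, for each link entering it. This turns the quantity that backpressure controls
  link by link into the node terms of the Lyapunov drift. The destination enters with its virtual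
  backlog and through its inflow only, because class \<open>c\<close> has no access to the links leaving it.\<close>

lemma sum_diff_backlog:
  fixes G :: "('n::finite, 'c) network"
  assumes "valid_network G" "\<And>l. l \<in> links G \<Longrightarrow> c \<notin> access G l \<Longrightarrow> x l = 0"
  shows "(\<Sum>l\<in>links G. x l * diff_backlog G w Q0 q z l c)
    = (\<Sum>n | n \<noteq> dest G c. q c n * (outflow G x n - inflow G x n))
      - dest_backlog w Q0 (z c) * inflow G x (dest G c)"
proof -
  let ?P = "ext_backlog G w Q0 q z c"
  have "(\<Sum>l\<in>links G. x l * diff_backlog G w Q0 q z l c)
      = (\<Sum>l\<in>links G. ?P (fst l) * x l) - (\<Sum>l\<in>links G. ?P (snd l) * x l)"
    by (simp add: diff_backlog_def sum_subtractf algebra_simps)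
  also have "\<dots> = (\<Sum>n\<in>UNIV. ?P n * (outflow G x n - inflow G x n))"
    unfolding sum_inflow[symmetric] sum_outflow[symmetric]
    by (simp add: sum_subtractf algebra_simps)
  also have "\<dots> = ?P (dest G c) * (outflow G x (dest G c) - inflow G x (dest G c))
      + (\<Sum>n | n \<noteq> dest G c. ?P n * (outflow G x n - inflow G x n))"
    by (rule sum_not_dest)
  also have "(\<Sum>n | n \<noteq> dest G c. ?P n * (outflow G x n - inflow G x n))
      = (\<Sum>n | n \<noteq> dest G c. q c n * (outflow G x n - inflow G x n))"
    by (rule sum.cong) (auto simp: ext_backlog_def)
  finally show ?thesis
    using outflow_dest[OF assms] by (simp add: ext_backlog_def)
qed

lemma sum_net_inflow:
  fixes G :: "('n::finite, 'c) network"
  assumes "valid_network G" "\<And>l. l \<in> links G \<Longrightarrow> c \<notin> access G l \<Longrightarrow> x l = 0"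
  shows "(\<Sum>n | n \<noteq> dest G c. inflow G x n - outflow G x n) = - inflow G x (dest G c)"
proof -
  have "(\<Sum>n\<in>UNIV. inflow G x n - outflow G x n) = 0"
    using sum_inflow[of "\<lambda>_. 1" G x] sum_outflow[of "\<lambda>_. 1" G x]
    by (simp add: sum_subtractf)
  then show ?thesis
    using outflow_dest[OF assms] sum_not_dest[of "\<lambda>n. inflow G x n - outflow G x n" "dest G c"]
    by simp
qed

lemma backpressure_rates:
  assumes "valid_network G" "backpressure G W x" "l \<in> links G"
  shows "0 \<le> x c l" "x c l \<le> cap G l" "c \<notin> access G l \<Longrightarrow> x c l = 0" "x c l \<noteq> 0 \<Longrightarrow> W l c > 0"
proof -
  have cap: "0 \<le> cap G l"
    using assms by (auto simp: valid_network_def)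
  have "0 \<le> x c l \<and> x c l \<le> cap G l \<and> (c \<notin> access G l \<longrightarrow> x c l = 0)
    \<and> (x c l \<noteq> 0 \<longrightarrow> W l c > 0)"
  proof (cases "access G l = {}")
    case True
    then show ?thesis
      using assms cap unfolding backpressure_def by auto
  next
    case False
    then obtain k where k: "is_arg_max (W l) (\<lambda>c. c \<in> access G l) k"
      and x: "\<And>c. x c l = (if c = k \<and> W l k > 0 then cap G l else 0)"
      using assms unfolding backpressure_def by metis
    show ?thesis
      using k x[of c] cap by (auto simp: is_arg_max_def split: if_splits)
  qed
  then show "0 \<le> x c l" "x c l \<le> cap G l" "c \<notin> access G l \<Longrightarrow> x c l = 0"
    "x c l \<noteq> 0 \<Longrightarrow> W l c > 0"
    by auto
qed

text \<open>The capacity of a link is best spent on one class of largest weight, or not at all when no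
  weight is positive.\<close>

lemma backpressure_maximizes:
  fixes G :: "('n, 'c::finite) network"
  assumes bp: "backpressure G W x" and l: "l \<in> links G"
    and f: "\<And>c. 0 \<le> f c" "\<And>c. c \<notin> access G l \<Longrightarrow> f c = 0" "(\<Sum>c\<in>UNIV. f c) \<le> cap G l"
  shows "(\<Sum>c\<in>UNIV. f c * W l c) \<le> (\<Sum>c\<in>UNIV. x c l * W l c)"
proof (cases "access G l = {}")
  case True
  then show ?thesis
    using bp l f(2) unfolding backpressure_def by auto
next
  case False
  then obtain k where k: "is_arg_max (W l) (\<lambda>c. c \<in> access G l) k"
    and x: "\<And>c. x c l = (if c = k \<and> W l k > 0 then cap G l else 0)"
    using bp l unfolding backpressure_def by metis
  have "(\<Sum>c\<in>UNIV. f c * W l c) \<le> (\<Sum>c\<in>UNIV. f c * max (W l k) 0)"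
  proof (rule sum_mono)
    fix c
    show "f c * W l c \<le> f c * max (W l k) 0"
    proof (cases "c \<in> access G l")
      case True
      then have "W l c \<le> W l k"
        using k by (auto simp: is_arg_max_def not_less)
      then show ?thesis
        using f(1)[of c] by (intro mult_left_mono) auto
    qed (simp add: f(2))
  qed
  also have "\<dots> = (\<Sum>c\<in>UNIV. f c) * max (W l k) 0"
    by (simp add: sum_distrib_right)
  also have "\<dots> \<le> cap G l * max (W l k) 0"
    using f(3) by (intro mult_right_mono) auto
  also have "\<dots> = (\<Sum>c\<in>UNIV. if c = k then (if W l k > 0 then cap G l * W l k else 0) else 0)"
    by simp
  also have "\<dots> = (\<Sum>c\<in>UNIV. x c l * W l c)"
    by (rule sum.cong) (auto simp: x)
  finally show ?thesis .
qed

text \<open>The flow witnessing \<open>r \<in> throughput_region G lam\<close> may deliver more than \<open>r c\<close>. Scaling the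
  flow of class \<open>c\<close> by a factor \<open>\<alpha> c \<le> 1\<close> makes it deliver exactly \<open>r c\<close>; conservation survives if
  the fraction \<open>1 - \<alpha> c\<close> of the arrivals is rejected in addition. Equality matters in the drift,
  where the surplus of the reference flow over \<open>r c\<close> is multiplied by the virtual backlog of the
  destination, and this backlog takes both signs.\<close>

lemma throughput_region_exact_flow:
  fixes G :: "('n::finite, 'c::finite) network"
  assumes "r \<in> throughput_region G lam" and lam: "\<And>c n. 0 \<le> lam c n"
  obtains f q where
    "\<And>c l. l \<in> links G \<Longrightarrow> 0 \<le> f c l"
    "\<And>c l. l \<in> links G \<Longrightarrow> c \<notin> access G l \<Longrightarrow> f c l = 0"
    "\<And>l. l \<in> links G \<Longrightarrow> (\<Sum>c\<in>UNIV. f c l) \<le> cap G l"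
    "\<And>c n. n \<noteq> dest G c \<Longrightarrow> 0 \<le> q c n"
    "\<And>c n. n \<noteq> dest G c \<Longrightarrow> outflow G (f c) n - inflow G (f c) n = lam c n - q c n"
    "\<And>c. inflow G (f c) (dest G c) = r c"
    "\<And>c. (\<Sum>n | n \<noteq> dest G c. q c n) = (\<Sum>n | n \<noteq> dest G c. lam c n) - r c"
proof -
  have "\<exists>f q. ((\<forall>c. \<forall>l\<in>links G. 0 \<le> f c l \<and> (c \<notin> access G l \<longrightarrow> f c l = 0)) \<and>
      (\<forall>l\<in>links G. (\<Sum>c\<in>UNIV. f c l) \<le> cap G l)) \<and>
      (\<forall>c n. n \<noteq> dest G c \<longrightarrow> 0 \<le> q c n \<and>
         lam c n + inflow G (f c) n = q c n + outflow G (f c) n) \<and>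
      (\<forall>c. 0 \<le> r c \<and> r c \<le> inflow G (f c) (dest G c) \<and> inflow G (f c) (dest G c)
         = (\<Sum>n | n \<noteq> dest G c. lam c n) - (\<Sum>n | n \<noteq> dest G c. q c n))"
    using assms(1) unfolding throughput_region_def mem_Collect_eq
    by (elim conjE exE, intro exI conjI) auto
  then obtain f q where
    flow: "(\<forall>c. \<forall>l\<in>links G. 0 \<le> f c l \<and> (c \<notin> access G l \<longrightarrow> f c l = 0)) \<and>
      (\<forall>l\<in>links G. (\<Sum>c\<in>UNIV. f c l) \<le> cap G l)"
    and rejected: "\<forall>c n. n \<noteq> dest G c \<longrightarrow> 0 \<le> q c n \<and>
         lam c n + inflow G (f c) n = q c n + outflow G (f c) n"
    and delivered: "\<forall>c. 0 \<le> r c \<and> r c \<le> inflow G (f c) (dest G c) \<and> inflow G (f c) (dest G c)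
         = (\<Sum>n | n \<noteq> dest G c. lam c n) - (\<Sum>n | n \<noteq> dest G c. q c n)"
    by (elim exE conjE) (rule that, intro conjI, assumption+)
  have f: "0 \<le> f c l" "c \<notin> access G l \<Longrightarrow> f c l = 0" "(\<Sum>c\<in>UNIV. f c l) \<le> cap G l"
    if "l \<in> links G" for c l
    using flow that by auto
  have q: "0 \<le> q c n" and cons: "lam c n + inflow G (f c) n = q c n + outflow G (f c) n"
    if "n \<noteq> dest G c" for c n
    using rejected that by auto
  have r: "0 \<le> r c" "r c \<le> inflow G (f c) (dest G c)"
    and tot: "inflow G (f c) (dest G c)
       = (\<Sum>n | n \<noteq> dest G c. lam c n) - (\<Sum>n | n \<noteq> dest G c. q c n)" for c
    using delivered by blast+
  define \<alpha> where
    "\<alpha> c = (if inflow G (f c) (dest G c) = 0 then 1 else r c / inflow G (f c) (dest G c))" for c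
  have \<alpha>: "0 \<le> \<alpha> c" "\<alpha> c \<le> 1" "\<alpha> c * inflow G (f c) (dest G c) = r c" for c
    using r[of c] by (auto simp: \<alpha>_def divide_le_eq_1)
  show ?thesis
  proof (rule that[of "\<lambda>c l. \<alpha> c * f c l" "\<lambda>c n. (1 - \<alpha> c) * lam c n + \<alpha> c * q c n"])
    show "0 \<le> \<alpha> c * f c l" if "l \<in> links G" for c l
      using \<alpha> f that by simp
    show "\<alpha> c * f c l = 0" if "l \<in> links G" "c \<notin> access G l" for c l
      using f that by simp
    show "(\<Sum>c\<in>UNIV. \<alpha> c * f c l) \<le> cap G l" if "l \<in> links G" for l
    proof -
      have "(\<Sum>c\<in>UNIV. \<alpha> c * f c l) \<le> (\<Sum>c\<in>UNIV. f c l)"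
        using \<alpha> f that by (intro sum_mono mult_left_le_one_le) auto
      with f(3)[OF that] show ?thesis
        by linarith
    qed
    show "0 \<le> (1 - \<alpha> c) * lam c n + \<alpha> c * q c n" if "n \<noteq> dest G c" for c n
      using \<alpha>[of c] q[OF that] lam[of c n] by simp
    show "outflow G (\<lambda>l. \<alpha> c * f c l) n - inflow G (\<lambda>l. \<alpha> c * f c l) n
        = lam c n - ((1 - \<alpha> c) * lam c n + \<alpha> c * q c n)" if "n \<noteq> dest G c" for c n
    proof -
      have "outflow G (f c) n - inflow G (f c) n = lam c n - q c n"
        using cons[OF that] by simp
      then have "\<alpha> c * (outflow G (f c) n - inflow G (f c) n) = \<alpha> c * (lam c n - q c n)"
        by simp
      then show ?thesis
        by (simp add: inflow_scale outflow_scale algebra_simps)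
    qed
    show "inflow G (\<lambda>l. \<alpha> c * f c l) (dest G c) = r c" for c
      using \<alpha> by (simp add: inflow_scale)
    show "(\<Sum>n | n \<noteq> dest G c. (1 - \<alpha> c) * lam c n + \<alpha> c * q c n)
        = (\<Sum>n | n \<noteq> dest G c. lam c n) - r c" for c
    proof -
      have "(\<Sum>n | n \<noteq> dest G c. (1 - \<alpha> c) * lam c n + \<alpha> c * q c n)
          = (1 - \<alpha> c) * (\<Sum>n | n \<noteq> dest G c. lam c n) + \<alpha> c * (\<Sum>n | n \<noteq> dest G c. q c n)"
        by (simp add: sum.distrib sum_distrib_left)
      also have "\<dots> = (\<Sum>n | n \<noteq> dest G c. lam c n) - \<alpha> c * inflow G (f c) (dest G c)"
        unfolding tot by (simp add: algebra_simps)
      finally show ?thesis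
        using \<alpha>(3) by simp
    qed
  qed
qed

section \<open>Drift of the queue potentials\<close>

lemma queue_square_drift:
  fixes q a b :: real
  assumes "0 \<le> q" "0 \<le> a" "0 \<le> b"
  shows "(max (q - a) 0 + b)\<^sup>2 \<le> q\<^sup>2 + a\<^sup>2 + b\<^sup>2 - 2 * q * (a - b)"
proof -
  have "(max (q - a) 0)\<^sup>2 \<le> (q - a)\<^sup>2"
    by (auto simp: max_def)
  moreover have "max (q - a) 0 * b \<le> q * b"
    using assms by (intro mult_right_mono) auto
  ultimately show ?thesis
    by (simp add: power2_eq_square algebra_simps)
qed

lemma exp_le_quadratic: "exp y \<le> 1 + y + y\<^sup>2 / 2 * exp \<bar>y\<bar>" for y :: real
proof -
  obtain t where t: "\<bar>t\<bar> \<le> \<bar>y\<bar>" "exp y = (\<Sum>k<2. y ^ k / fact k) + exp t / fact 2 * y ^ 2"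
    using Maclaurin_exp_le by blast
  have "exp t \<le> exp \<bar>y\<bar>"
    using t(1) by simp
  then have "exp t * y\<^sup>2 \<le> exp \<bar>y\<bar> * y\<^sup>2"
    by (intro mult_right_mono) auto
  then show ?thesis
    using t(2) by (simp add: numeral_2_eq_2 mult.commute)
qed

text \<open>The formula for \<open>w\<close> is tuned to \<open>w * \<delta>\<^sup>2 * exp (w * \<delta>) \<le> \<epsilon>\<close>: the second-order error of
  \<open>exp (w * x)\<close> over one slot is then a drift error of \<open>\<epsilon> / 2\<close>. It also gives \<open>w * \<delta> \<le> 1\<close>, because
  \<open>y * exp (- y) \<le> 1\<close>.\<close>

lemma potential_weight:
  fixes \<epsilon> \<delta> :: real
  assumes "\<epsilon> > 0" "\<delta> > 0" and w: "w = \<epsilon> / \<delta>\<^sup>2 * exp (- \<epsilon> / \<delta>)"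
  shows "w > 0" "w * \<delta> \<le> 1" "\<bar>x\<bar> \<le> \<delta> \<Longrightarrow> exp (w * x) \<le> 1 + w * x + w * \<epsilon> / 2"
proof -
  show "w > 0"
    using assms by simp
  have wd: "w * \<delta> = (\<epsilon> / \<delta>) * exp (- (\<epsilon> / \<delta>))"
    using assms by (simp add: power2_eq_square field_simps)
  have "\<epsilon> / \<delta> \<le> exp (\<epsilon> / \<delta>)"
    using exp_ge_add_one_self[of "\<epsilon> / \<delta>"] by linarith
  then show "w * \<delta> \<le> 1"
    unfolding wd using mult_right_mono[of "\<epsilon> / \<delta>" "exp (\<epsilon> / \<delta>)" "exp (- (\<epsilon> / \<delta>))"]
    by (simp flip: exp_add)
  have "w * \<delta> \<le> (\<epsilon> / \<delta>) * 1"
    unfolding wd using assms(1,2) by (intro mult_left_mono) auto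
  then have le: "exp (w * \<delta>) \<le> exp (\<epsilon> / \<delta>)"
    by simp
  have "w * \<delta>\<^sup>2 = \<epsilon> * exp (- (\<epsilon> / \<delta>))"
    using assms by (simp add: field_simps)
  then have "w * \<delta>\<^sup>2 * exp (w * \<delta>) \<le> \<epsilon> * exp (- (\<epsilon> / \<delta>)) * exp (\<epsilon> / \<delta>)"
    using le assms(1) by (simp add: mult_left_mono)
  then have curv: "w * \<delta>\<^sup>2 * exp (w * \<delta>) \<le> \<epsilon>"
    by (simp add: mult.assoc flip: exp_add)
  show "exp (w * x) \<le> 1 + w * x + w * \<epsilon> / 2" if x: "\<bar>x\<bar> \<le> \<delta>"
  proof -
    have "x\<^sup>2 \<le> \<delta>\<^sup>2"
      using power_mono[OF x, of 2] by simp
    moreover have "exp \<bar>w * x\<bar> \<le> exp (w * \<delta>)"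
      using x \<open>w > 0\<close> by (simp add: abs_mult)
    ultimately have "x\<^sup>2 * exp \<bar>w * x\<bar> \<le> \<delta>\<^sup>2 * exp (w * \<delta>)"
      by (intro mult_mono) auto
    then have "w * (w * (x\<^sup>2 * exp \<bar>w * x\<bar>)) \<le> w * (w * (\<delta>\<^sup>2 * exp (w * \<delta>)))"
      using \<open>w > 0\<close> by simp
    also have "\<dots> \<le> w * \<epsilon>"
      using curv \<open>w > 0\<close> by (intro mult_left_mono) (auto simp: mult.assoc)
    finally show ?thesis
      using exp_le_quadratic[of "w * x"] by (simp add: power_mult_distrib power2_eq_square field_simps)
  qed
qed

text \<open>\<open>dest_backlog w Q0\<close> is the derivative of the potential \<open>exp (w * \<bar>z - Q0\<bar>)\<close>, so up to the
  curvature error \<open>\<epsilon> / 2\<close> the drift is the derivative times the net change \<open>r - v\<close>. Here \<open>s\<close> is what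
  was actually received and \<open>r\<close> the allocated rate.

  Above \<open>Q0\<close> the derivative is nonnegative and replacing \<open>s\<close> by \<open>r\<close> only weakens the bound.
  Below \<open>Q0\<close> the derivative is negative and this replacement goes the wrong way. There the
  old potential alone pays for it, since \<open>w * r \<le> 1\<close>; the new potential is at most the constant
  \<open>exp (w * Q0)\<close>, or \<open>exp (w * (v_max + r_max))\<close> if the queue jumps across \<open>Q0\<close>, and the
  error term \<open>\<epsilon> / 2\<close> costs at most \<open>w * \<epsilon> / 2 * exp (w * Q0)\<close>.\<close>

lemma exp_potential_drift:
  fixes z z' v s r :: real
  assumes "\<epsilon> > 0" "\<delta> > 0" and w: "w = \<epsilon> / \<delta>\<^sup>2 * exp (- \<epsilon> / \<delta>)"
    and v: "0 \<le> v" "v \<le> v_max" "v_max \<le> \<delta>" "v_max \<le> Q0"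
    and s: "0 \<le> s" "s \<le> r" "r \<le> r_max" "r_max \<le> \<delta>"
    and z: "0 \<le> z" "z' = max (z - v) 0 + s"
  shows "exp (w * \<bar>z' - Q0\<bar>) - exp (w * \<bar>z - Q0\<bar>)
    \<le> exp (w * (v_max + r_max)) + w * \<epsilon> / 2 * exp (w * Q0) + exp (w * Q0)
      - dest_backlog w Q0 z * (v - r - \<epsilon> / 2)"
proof -
  note w_props = potential_weight[OF assms(1,2) w]
  define U where "U = dest_backlog w Q0 z"
  have z': "0 \<le> z'"
    using z s by simp
  have Q0: "0 \<le> Q0"
    using v by linarith
  have nonneg: "0 \<le> w * \<epsilon> / 2 * exp (w * Q0)"
    using w_props(1) assms(1) by simp
  show ?thesis
  proof (cases "z \<ge> Q0")
    case True
    then have U: "U = w * exp (w * (z - Q0))" and "U \<ge> 0"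
      using w_props(1) by (auto simp: U_def dest_backlog_def)
    have eq: "z' = z - v + s"
      using z True v by auto
    have "exp (w * (z' - Q0)) = exp (w * (z - Q0)) * exp (w * (s - v))"
      unfolding eq by (simp add: algebra_simps flip: exp_add)
    also have "\<dots> \<le> exp (w * (z - Q0)) * (1 + w * (s - v) + w * \<epsilon> / 2)"
      using v s by (intro mult_left_mono w_props(3)) auto
    also have "\<dots> = exp (w * (z - Q0)) - U * (v - s - \<epsilon> / 2)"
      unfolding U by (simp add: algebra_simps)
    finally have up: "exp (w * (z' - Q0)) - exp (w * \<bar>z - Q0\<bar>) \<le> - U * (v - s - \<epsilon> / 2)"
      using True by simp
    have "exp (w * \<bar>z' - Q0\<bar>) \<le> exp (w * (z' - Q0)) + exp (w * (v_max + r_max))"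
    proof (cases "z' \<ge> Q0")
      case False
      then have "\<bar>z' - Q0\<bar> \<le> v_max + r_max"
        using eq True v s by linarith
      then have "exp (w * \<bar>z' - Q0\<bar>) \<le> exp (w * (v_max + r_max))"
        using w_props(1) by simp
      then show ?thesis
        by (simp add: add_increasing)
    qed simp
    moreover have "- U * (v - s - \<epsilon> / 2) \<le> - U * (v - r - \<epsilon> / 2)"
      using \<open>U \<ge> 0\<close> s by (simp add: mult_left_mono)
    moreover have "0 \<le> exp (w * Q0)"
      by simp
    ultimately show ?thesis
      using up nonneg unfolding U_def[symmetric] by linarith
  next
    case False
    then have U: "U = - (w * exp (w * (Q0 - z)))"
      by (auto simp: U_def dest_backlog_def)
    have abs: "\<bar>z - Q0\<bar> = Q0 - z"
      using False by simp
    \<comment> \<open>the old potential \<open>exp (w * \<bar>z - Q0\<bar>)\<close> dominates \<open>- U * r\<close>\<close>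
    have "w * r \<le> w * \<delta>"
      using s w_props(1) by (intro mult_left_mono) auto
    then have "w * r \<le> 1"
      using w_props(2) by linarith
    then have "exp (w * (Q0 - z)) * (w * r) \<le> exp (w * (Q0 - z)) * 1"
      by (intro mult_left_mono) auto
    then have old: "- exp (w * \<bar>z - Q0\<bar>) \<le> U * r"
      unfolding U abs by (simp add: algebra_simps)
    have "0 \<le> - U * v"
      unfolding U using v w_props(1) by simp
    moreover have "- U * \<epsilon> / 2 \<le> w * \<epsilon> / 2 * exp (w * Q0)"
    proof -
      have "exp (w * (Q0 - z)) \<le> exp (w * Q0)"
        using z w_props(1) by simp
      then have "w * \<epsilon> / 2 * exp (w * (Q0 - z)) \<le> w * \<epsilon> / 2 * exp (w * Q0)"
        using w_props(1) assms(1) by (intro mult_left_mono) auto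
      then show ?thesis
        unfolding U by (simp add: algebra_simps)
    qed
    moreover have "exp (w * \<bar>z' - Q0\<bar>) \<le> exp (w * (v_max + r_max)) + exp (w * Q0)"
    proof (cases "z' \<ge> Q0")
      case True
      then have "\<bar>z' - Q0\<bar> \<le> v_max + r_max"
        using z False v s by linarith
      then have "exp (w * \<bar>z' - Q0\<bar>) \<le> exp (w * (v_max + r_max))"
        using w_props(1) by simp
      then show ?thesis
        by (simp add: add_increasing2)
    next
      case False
      then have "exp (w * \<bar>z' - Q0\<bar>) \<le> exp (w * Q0)"
        using z' w_props(1) by simp
      then show ?thesis
        by (simp add: add_increasing)
    qed
    ultimately show ?thesis
      using old unfolding U_def[symmetric] by (simp add: algebra_simps)
  qed
qed

section \<open>Concave utilities\<close>

text \<open>The slope of a chord starting at \<open>x\<close> does not increase as the chord grows, so the full chord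
  is not steeper than the tangent. The derivative is taken along the segment from \<open>x\<close> to \<open>y\<close>, which
  covers a boundary point \<open>x\<close>: utilities are defined on \<open>{0..}\<close> and a throughput may be \<open>0\<close>.\<close>

lemma concave_on_le_tangent:
  fixes f :: "real \<Rightarrow> real"
  assumes f: "concave_on S f" and x: "x \<in> S" and y: "y \<in> S"
    and deriv: "(f has_real_derivative f') (at x within S)"
  shows "f y \<le> f x + f' * (y - x)"
proof (cases "y = x")
  case False
  define p where "p s = x + s * (y - x)" for s
  have conv: "p s \<in> S" "f (p s) \<ge> (1 - s) * f x + s * f y" if "s \<in> {0..1}" for s
  proof -
    have eq: "p s = (1 - s) *\<^sub>R x + s *\<^sub>R y"
      by (simp add: p_def algebra_simps)
    have cS: "convex S"
      using f by (simp add: concave_on_def convex_on_def)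
    show "p s \<in> S"
      unfolding eq using that x y cS by (intro convexD) auto
    have "convex_on S (\<lambda>x. - f x)"
      using f by (simp add: concave_on_def)
    then have "- f ((1 - s) *\<^sub>R x + s *\<^sub>R y) \<le> (1 - s) * - f x + s * - f y"
      using that x y by (intro convex_onD) auto
    then show "f (p s) \<ge> (1 - s) * f x + s * f y"
      unfolding eq by simp
  qed
  have "((f \<circ> p) has_real_derivative f' * (y - x)) (at 0 within {0..1})"
  proof (rule DERIV_image_chain)
    have "p 0 = x"
      by (simp add: p_def)
    moreover have "p ` {0..1} \<subseteq> S"
      using conv(1) by auto
    ultimately show "(f has_real_derivative f') (at (p 0) within p ` {0..1})"
      using deriv DERIV_subset by metis
    show "(p has_real_derivative y - x) (at 0 within {0..1})"
      unfolding p_def by (auto intro!: derivative_eq_intros)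
  qed
  then have "((\<lambda>s. (f (p s) - f (p 0)) / (s - 0)) \<longlongrightarrow> f' * (y - x)) (at 0 within {0..1})"
    by (simp add: has_field_derivative_iff)
  moreover have "at (0::real) within {0..1} \<noteq> bot"
    by (simp add: at_within_Icc_at_right)
  moreover have "eventually (\<lambda>s. f y - f x \<le> (f (p s) - f (p 0)) / (s - 0)) (at 0 within {0..1})"
    unfolding eventually_at_filter
  proof (intro always_eventually allI impI)
    fix s :: real assume s: "s \<noteq> 0" "s \<in> {0..1}"
    then have "s * (f y - f x) \<le> f (p s) - f (p 0)"
      using conv(2)[of s] by (simp add: p_def algebra_simps)
    then show "f y - f x \<le> (f (p s) - f (p 0)) / (s - 0)"
      using s by (simp add: field_simps)
  qed
  ultimately have "f y - f x \<le> f' * (y - x)"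
    using tendsto_lowerbound by blast
  then show ?thesis
    by simp
qed simp

section \<open>Network parameters and utilities\<close>

locale uora_network =
  fixes G :: "('n::finite, 'c::finite) network"
    and A_max d_max \<epsilon> \<nu>_max \<delta>_max w Q0 V :: real
    and \<theta> m :: "'c \<Rightarrow> real"
    and g g' :: "'c \<Rightarrow> real \<Rightarrow> real"
  assumes net: "valid_network G"
    and A_max: "0 \<le> A_max"
    and d_max: "A_max + mu_in_max G \<le> d_max"
    and eps: "\<epsilon> > 0"
    and nu_max: "\<nu>_max > 0"
    and delta_max: "\<delta>_max = max \<nu>_max (mu_in_max G)"
    and w: "w = \<epsilon> / \<delta>_max\<^sup>2 * exp (- \<epsilon> / \<delta>_max)"
    and Q0: "\<nu>_max \<le> Q0"
    and V_pos: "V > 0"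
    and theta_pos: "\<theta> c > 0"
    and g_concave: "concave_on {0..} (g c)"
    and g_incr: "mono_on {0..} (g c)"
    and g_deriv: "x \<ge> 0 \<Longrightarrow> (g c has_real_derivative g' c x) (at x within {0..})"
    and g'_bound: "x \<ge> 0 \<Longrightarrow> \<bar>g' c x\<bar> \<le> m c"
    and theta: "x \<ge> \<epsilon> \<Longrightarrow> g' c x \<le> \<theta> c"
begin

definition slot_constant :: real where
  "slot_constant = real CARD('n) * real CARD('c) *
       ((mu_out_max G + d_max)\<^sup>2 + (A_max + mu_in_max G)\<^sup>2 + 2 * d_max\<^sup>2)
     + real CARD('c) *
       (exp (w * (\<nu>_max + mu_in_max G)) + w * \<epsilon> / 2 * exp (w * Q0) + exp (w * Q0))"

definition Q_bound :: "'c \<Rightarrow> real" where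
  "Q_bound c = V * \<theta> c + 2 * d_max"

definition Z_bound :: "'c \<Rightarrow> real" where
  "Z_bound c = Q0 + Q_bound c / w\<^sup>2 + mu_in_max G"

text \<open>A horizon-independent bound for what the initial and the final contents of all queues
  contribute to the utility accounting. It depends on the parameters alone, so it is the same for all
  sample paths and vanishes in the time average.\<close>

definition overhead :: real where
  "overhead = (\<Sum>c\<in>UNIV. real (card {n. n \<noteq> dest G c}) * ((V * \<theta> c)\<^sup>2 / 2) + exp (w * Q0)) / V
     + (\<Sum>c\<in>UNIV. \<theta> c * (real (card {n. n \<noteq> dest G c}) * (Q_bound c + d_max) + Z_bound c))"

lemma delta_pos: "\<delta>_max > 0"
  using nu_max delta_max by simp

lemmas w_pos = potential_weight(1)[OF eps delta_pos w]

lemma cap_nonneg: "l \<in> links G \<Longrightarrow> 0 \<le> cap G l"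
  using net by (auto simp: valid_network_def)

lemma mu_in_max_nonneg: "0 \<le> mu_in_max G"
proof -
  have "0 \<le> inflow G (\<lambda>_. 0) undefined"
    by (simp add: inflow_def)
  also have "\<dots> \<le> mu_in_max G"
    by (rule inflow_le_mu_in_max) (simp add: cap_nonneg)
  finally show ?thesis .
qed

lemma d_max_nonneg: "0 \<le> d_max"
  using A_max d_max mu_in_max_nonneg by linarith

lemma utility_tangent: "0 \<le> x \<Longrightarrow> 0 \<le> y \<Longrightarrow> g c y \<le> g c x + g' c x * (y - x)"
  by (rule concave_on_le_tangent[OF g_concave]) (use g_deriv in auto)

lemma utility_lipschitz:
  assumes "0 \<le> x" "x \<le> y"
  shows "g c y \<le> g c x + m c * (y - x)"
proof -
  have "g' c x * (y - x) \<le> m c * (y - x)"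
    using assms g'_bound[of x c] by (intro mult_right_mono) auto
  then show ?thesis
    using utility_tangent[of x y c] assms by linarith
qed

text \<open>Admitting \<open>\<nu>\<close> but delivering only \<open>r\<close> is charged \<open>\<theta> c * (\<nu> - r)\<close>. Beyond \<open>\<epsilon>\<close> the marginal
  utility is at most \<open>\<theta> c\<close>, so there the charge outweighs the gain from admitting more; only the part
  of \<open>\<nu>\<close> between \<open>r\<close> and \<open>\<epsilon>\<close> can gain, and at most \<open>m c * \<epsilon>\<close>. This is where fictitious
  admissions are converted into a statement on real throughput. The slack \<open>s\<close> absorbs the data still
  in the virtual queue at the end of a finite horizon.\<close>

lemma admission_gap:
  assumes r: "0 \<le> r" and \<nu>: "0 \<le> \<nu>" and s: "0 \<le> s" "r \<le> \<nu> + s"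
  shows "g c \<nu> - \<theta> c * (\<nu> - r) \<le> g c r + m c * \<epsilon> + \<theta> c * s"
proof -
  define y where "y = \<nu> + s"
  define z where "z = max r (min \<epsilon> y)"
  have m: "0 \<le> m c"
    using g'_bound[of 0 c] by simp
  have z: "r \<le> z" "z \<le> y" "z - r \<le> \<epsilon>"
    using assms eps by (auto simp: z_def y_def)
  have "m c * (z - r) \<le> m c * \<epsilon>"
    using z m by (intro mult_left_mono) auto
  then have 1: "g c z \<le> g c r + m c * \<epsilon>"
    using utility_lipschitz[of r z c] r z by linarith
  have 2: "g c y \<le> g c z + \<theta> c * (y - z)"
  proof (cases "z = y")
    case False
    then have "\<epsilon> \<le> z"
      using z by (auto simp: z_def max_def min_def split: if_splits)
    then have "g' c z * (y - z) \<le> \<theta> c * (y - z)"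
      using theta z by (intro mult_right_mono) auto
    then show ?thesis
      using utility_tangent[of z y c] z r by linarith
  qed simp
  have 3: "g c \<nu> \<le> g c y"
    using g_incr[of c] \<nu> s by (auto simp: y_def intro: mono_onD)
  have "\<theta> c * (y - z) \<le> \<theta> c * (y - r)"
    using theta_pos[of c] z by (intro mult_left_mono) auto
  moreover have "\<theta> c * (y - r) = \<theta> c * (\<nu> - r) + \<theta> c * s"
    by (simp add: y_def algebra_simps)
  ultimately show ?thesis
    using 1 2 3 by linarith
qed

end

section \<open>One sample path of the policy\<close>

text \<open>Up to the final expectation the argument is deterministic. The locale describes one
  realization of arrivals, decisions and queues.\<close>

locale uora_path = uora_network G A_max d_max \<epsilon> \<nu>_max \<delta>_max w Q0 V \<theta> m g g'
  for G :: "('n::finite, 'c::finite) network"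
    and A_max d_max \<epsilon> \<nu>_max \<delta>_max w Q0 V :: real
    and \<theta> m :: "'c \<Rightarrow> real"
    and g g' :: "'c \<Rightarrow> real \<Rightarrow> real" +
  fixes A Q D d \<phi> dtil :: "'c \<Rightarrow> 'n \<Rightarrow> nat \<Rightarrow> real"
    and \<mu> mutil :: "'c \<Rightarrow> 'n \<times> 'n \<Rightarrow> nat \<Rightarrow> real"
    and Z \<nu> :: "'c \<Rightarrow> nat \<Rightarrow> real"
  assumes A_nonneg: "0 \<le> A c n t" and A_le: "A c n t \<le> A_max"
    and d: "n \<noteq> dest G c \<Longrightarrow> d c n t = (if Q c n t > D c n t then d_max else 0)"
    and phi: "n \<noteq> dest G c \<Longrightarrow> \<phi> c n t = (if D c n t > V * \<theta> c then d_max else 0)"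
    and dtil: "n \<noteq> dest G c \<Longrightarrow>
      dtil c n t = min (max (Q c n t - outflow G (\<lambda>l. \<mu> c l t) n) 0) (d c n t)"
    and mu: "backpressure G (diff_backlog G w Q0 (\<lambda>c n. Q c n t) (\<lambda>c. Z c t)) (\<lambda>c l. \<mu> c l t)"
    and mutil_bounds: "l \<in> links G \<Longrightarrow> 0 \<le> mutil c l t \<and> mutil c l t \<le> \<mu> c l t"
    and mutil_total: "n \<noteq> dest G c \<Longrightarrow>
      outflow G (\<lambda>l. mutil c l t) n = min (Q c n t) (outflow G (\<lambda>l. \<mu> c l t) n)"
    and nu: "is_arg_max (\<lambda>x. V * (g c x - \<theta> c * x) + x * dest_backlog w Q0 (Z c t))
      (\<lambda>x. 0 \<le> x \<and> x \<le> \<nu>_max) (\<nu> c t)"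
    and Q_init: "n \<noteq> dest G c \<Longrightarrow> Q c n 0 = 0"
    and Q_step: "n \<noteq> dest G c \<Longrightarrow>
      Q c n (Suc t) = Q c n t - outflow G (\<lambda>l. mutil c l t) n - dtil c n t + A c n t
        + inflow G (\<lambda>l. mutil c l t) n"
    and D_init: "n \<noteq> dest G c \<Longrightarrow> D c n 0 = V * \<theta> c"
    and D_step: "n \<noteq> dest G c \<Longrightarrow> D c n (Suc t) = max (D c n t - \<phi> c n t) 0 + dtil c n t"
    and Z_init: "Z c 0 = 0"
    and Z_step: "Z c (Suc t) = max (Z c t - \<nu> c t) 0 + inflow G (\<lambda>l. mutil c l t) (dest G c)"
begin

lemmas mu_rates = backpressure_rates[OF net mu]

lemma mutil_rates:
  assumes "l \<in> links G"
  shows "0 \<le> mutil c l t" "mutil c l t \<le> \<mu> c l t" "mutil c l t \<le> cap G l"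
    "c \<notin> access G l \<Longrightarrow> mutil c l t = 0"
  using mutil_bounds[OF assms, of c t] mu_rates[OF assms, of c t] by auto

lemma flow_bounds:
  "0 \<le> inflow G (\<lambda>l. mutil c l t) n"
  "inflow G (\<lambda>l. mutil c l t) n \<le> inflow G (\<lambda>l. \<mu> c l t) n"
  "inflow G (\<lambda>l. \<mu> c l t) n \<le> mu_in_max G"
  "0 \<le> outflow G (\<lambda>l. \<mu> c l t) n"
  "outflow G (\<lambda>l. \<mu> c l t) n \<le> mu_out_max G"
  using mutil_rates mu_rates
  by (auto intro!: inflow_nonneg inflow_mono inflow_le_mu_in_max outflow_nonneg outflow_le_mu_out_max)

lemma inflow_mutil_le: "inflow G (\<lambda>l. mutil c l t) n \<le> mu_in_max G"
  using flow_bounds(2,3) order_trans by blast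

lemma nu_range: "0 \<le> \<nu> c t" "\<nu> c t \<le> \<nu>_max"
  using nu[of c t] by (auto simp: is_arg_max_def)

lemma nu_optimal:
  assumes "0 \<le> x" "x \<le> \<nu>_max"
  shows "V * (g c x - \<theta> c * x) + x * dest_backlog w Q0 (Z c t)
    \<le> V * (g c (\<nu> c t) - \<theta> c * \<nu> c t) + \<nu> c t * dest_backlog w Q0 (Z c t)"
  using nu[of c t] assms by (auto simp: is_arg_max_def not_less)

lemma drop_ranges:
  assumes "n \<noteq> dest G c"
  shows "0 \<le> d c n t" "d c n t \<le> d_max" "0 \<le> \<phi> c n t" "\<phi> c n t \<le> d_max"
    "0 \<le> dtil c n t" "dtil c n t \<le> d c n t"
  using d[OF assms] phi[OF assms] dtil[OF assms] d_max_nonneg by auto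

text \<open>The packets that a node really sends and drops remove exactly what the allocated rates would
  remove from a queue truncated at \<open>0\<close>.\<close>

lemma Q_step':
  assumes "n \<noteq> dest G c"
  shows "Q c n (Suc t) = max (Q c n t - (outflow G (\<lambda>l. \<mu> c l t) n + d c n t)) 0
    + (A c n t + inflow G (\<lambda>l. mutil c l t) n)"
  using drop_ranges(1)[OF assms, of t]
  unfolding Q_step[OF assms] mutil_total[OF assms] dtil[OF assms]
  by (auto simp: min_def max_def)

lemma Q_nonneg: "n \<noteq> dest G c \<Longrightarrow> 0 \<le> Q c n t"
proof (cases t)
  case (Suc k)
  assume "n \<noteq> dest G c"
  then show ?thesis
    using Q_step'[of n c k] A_nonneg[of c n k] flow_bounds(1)[of c k n] Suc by simp
qed (simp add: Q_init)

text \<open>Above its threshold a queue is drained at rate \<open>d_max\<close>, which is at least what can enter it in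
  one slot, so it does not grow past the larger of its present size and \<open>d_max\<close>. From below the
  threshold one slot adds at most \<open>d_max\<close>. For \<open>D\<close> the threshold is \<open>V * \<theta> c\<close>; for \<open>Q\<close> it is \<open>D\<close>, which is at
  most \<open>V * \<theta> c + d_max\<close>, and this yields \<open>Q_bound\<close>.\<close>

lemma D_bounds:
  assumes n: "n \<noteq> dest G c"
  shows "0 \<le> D c n t \<and> D c n t \<le> V * \<theta> c + d_max"
proof (induction t)
  case 0
  then show ?case
    using D_init[OF n] V_pos theta_pos[of c] d_max_nonneg by simp
next
  case (Suc t)
  then show ?case
    using drop_ranges[OF n, of t] D_step[OF n, of t] phi[OF n, of t]
      mult_pos_pos[OF V_pos theta_pos[of c]]
    by (auto simp: max_def split: if_splits)
qed

lemma Q_le: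
  assumes n: "n \<noteq> dest G c"
  shows "Q c n t \<le> Q_bound c"
proof (induction t)
  case 0
  then show ?case
    using Q_init[OF n] V_pos theta_pos[of c] d_max_nonneg by (simp add: Q_bound_def)
next
  case (Suc t)
  have in_le: "A c n t + inflow G (\<lambda>l. mutil c l t) n \<le> d_max"
    using A_le[of c n t] inflow_mutil_le[of c t n] d_max by linarith
  have base: "2 * d_max \<le> Q_bound c"
    using V_pos theta_pos[of c] by (simp add: Q_bound_def)
  show ?case
  proof (cases "Q c n t > D c n t")
    case True
    then show ?thesis
      using Q_step'[OF n, of t] d[OF n, of t] in_le base Suc flow_bounds(4)[of c t n] d_max_nonneg
      by (auto simp: max_def)
  next
    case False
    then show ?thesis
      using Q_step'[OF n, of t] d[OF n, of t] in_le base D_bounds[OF n, of t]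
        flow_bounds(4)[of c t n] d_max_nonneg
      by (auto simp: max_def Q_bound_def)
  qed
qed

lemma Z_nonneg: "0 \<le> Z c t"
  using Z_init Z_step flow_bounds(1) by (cases t) auto

text \<open>Once the virtual backlog of the destination exceeds every possible real backlog of the class,
  no link into the destination has positive weight and the virtual queue receives nothing. The level
  \<open>z\<close> below is large enough for this by the crude estimate \<open>y \<le> exp y\<close>.\<close>

lemma Z_le: "Z c t \<le> Z_bound c"
proof (induction t)
  case 0
  have "0 \<le> Q_bound c"
    using V_pos theta_pos[of c] d_max_nonneg by (simp add: Q_bound_def)
  then show ?case
    using Z_init[of c] nu_max Q0 mu_in_max_nonneg by (simp add: Z_bound_def)
next
  case (Suc t)
  define z where "z = Q0 + Q_bound c / w\<^sup>2"
  have z: "Z_bound c = z + mu_in_max G"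
    by (simp add: z_def Z_bound_def)
  show ?case
  proof (cases "Z c t \<le> z")
    case True
    have "max (Z c t - \<nu> c t) 0 \<le> Z c t"
      using Z_nonneg[of c t] nu_range(1)[of c t] by simp
    then show ?thesis
      using True Z_step[of c t] inflow_mutil_le[of c t "dest G c"] z by linarith
  next
    case False
    have Qb: "0 \<le> Q_bound c"
      using V_pos theta_pos[of c] d_max_nonneg by (simp add: Q_bound_def)
    then have zQ: "Q0 \<le> z"
      by (simp add: z_def)
    have "Q_bound c = w\<^sup>2 * (z - Q0)"
      using w_pos by (simp add: z_def)
    also have "\<dots> \<le> w\<^sup>2 * (Z c t - Q0)"
      using False by (intro mult_left_mono) auto
    also have "\<dots> = w * (w * (Z c t - Q0))"
      by (simp add: power2_eq_square)
    also have "\<dots> \<le> w * exp (w * (Z c t - Q0))"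
    proof (rule mult_left_mono)
      show "w * (Z c t - Q0) \<le> exp (w * (Z c t - Q0))"
        using exp_ge_add_one_self[of "w * (Z c t - Q0)"] by linarith
    qed (use w_pos in simp)
    also have "\<dots> = dest_backlog w Q0 (Z c t)"
      using False zQ by (simp add: dest_backlog_def)
    finally have U: "Q_bound c \<le> dest_backlog w Q0 (Z c t)" .
    have "mutil c (a, dest G c) t = 0" if l: "(a, dest G c) \<in> links G" for a
    proof -
      have "diff_backlog G w Q0 (\<lambda>c n. Q c n t) (\<lambda>c. Z c t) (a, dest G c) c \<le> 0"
        using U Q_le[of a c t] by (auto simp: diff_backlog_def ext_backlog_def)
      then have "\<mu> c (a, dest G c) t = 0"
        using mu_rates(4)[OF l, of c t] by linarith
      then show ?thesis
        using mutil_rates(1,2)[OF l, of c t] by linarith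
    qed
    then have "inflow G (\<lambda>l. mutil c l t) (dest G c) = 0"
      unfolding inflow_def by (intro sum.neutral) auto
    then show ?thesis
      using Z_step[of c t] Suc nu_range(1)[of c t] Z_nonneg[of c t] by simp
  qed
qed

subsection \<open>Drift of the Lyapunov function\<close>

definition lyapunov :: "nat \<Rightarrow> real" where
  "lyapunov t = (\<Sum>c\<in>UNIV. (\<Sum>n | n \<noteq> dest G c. ((Q c n t)\<^sup>2 + (D c n t)\<^sup>2) / 2)
     + exp (w * \<bar>Z c t - Q0\<bar>))"

text \<open>On the right the actual drops are replaced by the allocated drop rate, which makes the bound
  linear in the control decisions. The coefficient \<open>Q - D\<close> of \<open>d\<close> is the one
  whose sign the dropping rule inspects.\<close>

lemma node_drift:
  assumes n: "n \<noteq> dest G c"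
  shows "((Q c n (Suc t))\<^sup>2 + (D c n (Suc t))\<^sup>2) / 2 \<le> ((Q c n t)\<^sup>2 + (D c n t)\<^sup>2) / 2
    + ((mu_out_max G + d_max)\<^sup>2 + (A_max + mu_in_max G)\<^sup>2 + 2 * d_max\<^sup>2)
    - Q c n t * (outflow G (\<lambda>l. \<mu> c l t) n - inflow G (\<lambda>l. \<mu> c l t) n) + Q c n t * A c n t
    - (Q c n t - D c n t) * d c n t - D c n t * \<phi> c n t"
proof -
  define a where "a = outflow G (\<lambda>l. \<mu> c l t) n + d c n t"
  define b where "b = A c n t + inflow G (\<lambda>l. mutil c l t) n"
  note dr = drop_ranges[OF n, of t]
  have a: "0 \<le> a" "a \<le> mu_out_max G + d_max"
    using dr flow_bounds(4,5)[of c t n] by (auto simp: a_def)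
  have b: "0 \<le> b" "b \<le> A_max + mu_in_max G" "b \<le> A c n t + inflow G (\<lambda>l. \<mu> c l t) n"
    using A_nonneg[of c n t] A_le[of c n t] flow_bounds(1,2,3)[of c t n] by (auto simp: b_def)
  have "(Q c n (Suc t))\<^sup>2 \<le> (Q c n t)\<^sup>2 + a\<^sup>2 + b\<^sup>2 - 2 * Q c n t * (a - b)"
    unfolding Q_step'[OF n] a_def[symmetric] b_def[symmetric]
    using Q_nonneg[OF n, of t] a(1) b(1) by (rule queue_square_drift)
  moreover have "(D c n (Suc t))\<^sup>2
      \<le> (D c n t)\<^sup>2 + (\<phi> c n t)\<^sup>2 + (dtil c n t)\<^sup>2 - 2 * D c n t * (\<phi> c n t - dtil c n t)"
    unfolding D_step[OF n] using D_bounds[OF n, of t] dr by (intro queue_square_drift) auto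
  moreover have "a\<^sup>2 \<le> (mu_out_max G + d_max)\<^sup>2" "b\<^sup>2 \<le> (A_max + mu_in_max G)\<^sup>2"
    "(\<phi> c n t)\<^sup>2 \<le> d_max\<^sup>2" "(dtil c n t)\<^sup>2 \<le> d_max\<^sup>2"
    using a b dr by (auto intro!: power_mono)
  moreover have "D c n t * dtil c n t \<le> D c n t * d c n t"
    using D_bounds[OF n, of t] dr by (intro mult_left_mono) auto
  moreover have "Q c n t * b \<le> Q c n t * (A c n t + inflow G (\<lambda>l. \<mu> c l t) n)"
    using Q_nonneg[OF n, of t] b(3) by (intro mult_left_mono)
  moreover have "0 \<le> (mu_out_max G + d_max)\<^sup>2" "0 \<le> (A_max + mu_in_max G)\<^sup>2" "0 \<le> d_max\<^sup>2"
    by auto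
  ultimately show ?thesis
    unfolding a_def ring_distribs by argo
qed

lemma virtual_queue_drift:
  "exp (w * \<bar>Z c (Suc t) - Q0\<bar>) \<le> exp (w * \<bar>Z c t - Q0\<bar>)
    + (exp (w * (\<nu>_max + mu_in_max G)) + w * \<epsilon> / 2 * exp (w * Q0) + exp (w * Q0))
    - dest_backlog w Q0 (Z c t) * (\<nu> c t - inflow G (\<lambda>l. \<mu> c l t) (dest G c) - \<epsilon> / 2)"
  using exp_potential_drift[OF eps delta_pos w nu_range _ Q0 flow_bounds(1,2,3) _ Z_nonneg Z_step, of c t]
    delta_max by simp

text \<open>The drift-plus-penalty inequality. Up to constants, the Lyapunov drift with the penalty
  \<open>V * (\<theta> * \<phi> - (g \<nu> - \<theta> * \<nu>))\<close> added is bounded by a sum of terms, each of which depends on one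
  control decision, and the policy minimizes every one of them. Therefore the rates of a reference
  policy may be substituted: route along a flow \<open>f\<close> that delivers exactly \<open>r\<close>, drop at its rejection
  rate \<open>q\<close> (admissible, since \<open>q \<le> A_max + mu_in_max G \<le> d_max\<close>), let \<open>\<phi>\<close> be \<open>q\<close> as well, and
  admit \<open>r + \<epsilon> / 2\<close>, where the extra \<open>\<epsilon> / 2\<close> cancels the curvature error of the exponential
  potential. All backlogs then cancel, except in the fluctuation \<open>Q * (A - lam)\<close> of the arrivals.\<close>

lemma slot_drift:
  assumes r: "r \<in> throughput_region G lam"
    and lam: "\<And>c n. 0 \<le> lam c n" "\<And>c n. lam c n \<le> A_max"
    and r_le: "\<And>c. r c + \<epsilon> / 2 \<le> \<nu>_max"
  shows "lyapunov (Suc t) + V * (\<Sum>c\<in>UNIV. \<theta> c * (\<Sum>n | n \<noteq> dest G c. \<phi> c n t))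
      - V * (\<Sum>c\<in>UNIV. g c (\<nu> c t) - \<theta> c * \<nu> c t)
    \<le> lyapunov t + slot_constant
      + (\<Sum>c\<in>UNIV. \<Sum>n | n \<noteq> dest G c. Q c n t * (A c n t - lam c n))
      + V * (\<Sum>c\<in>UNIV. \<theta> c * ((\<Sum>n | n \<noteq> dest G c. lam c n) - r c))
      - V * (\<Sum>c\<in>UNIV. g c (r c + \<epsilon> / 2) - \<theta> c * (r c + \<epsilon> / 2))"
proof -
  obtain f q where
    f: "\<And>c l. l \<in> links G \<Longrightarrow> 0 \<le> f c l"
      "\<And>c l. l \<in> links G \<Longrightarrow> c \<notin> access G l \<Longrightarrow> f c l = 0"
      "\<And>l. l \<in> links G \<Longrightarrow> (\<Sum>c\<in>UNIV. f c l) \<le> cap G l"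
    and q: "\<And>c n. n \<noteq> dest G c \<Longrightarrow> 0 \<le> q c n"
    and net_out: "\<And>c n. n \<noteq> dest G c \<Longrightarrow> outflow G (f c) n - inflow G (f c) n = lam c n - q c n"
    and f_dest: "\<And>c. inflow G (f c) (dest G c) = r c"
    and q_total: "\<And>c. (\<Sum>n | n \<noteq> dest G c. q c n) = (\<Sum>n | n \<noteq> dest G c. lam c n) - r c"
    using throughput_region_exact_flow[OF r lam(1)] by blast
  have f_le: "f c l \<le> cap G l" if "l \<in> links G" for c l
  proof -
    have "f c l \<le> (\<Sum>c\<in>UNIV. f c l)"
      using f(1)[OF that] by (intro member_le_sum) auto
    with f(3)[OF that] show ?thesis
      by linarith
  qed
  have q_le: "q c n \<le> d_max" if "n \<noteq> dest G c" for c n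
  proof -
    have "inflow G (f c) n \<le> mu_in_max G" "0 \<le> outflow G (f c) n"
      using f_le f(1) by (auto intro: inflow_le_mu_in_max outflow_nonneg)
    then show ?thesis
      using net_out[OF that] lam(2)[of c n] d_max by linarith
  qed
  have r_nonneg: "0 \<le> r c" for c
    using f_dest[of c] f(1) inflow_nonneg[of G "f c" "dest G c"] by simp

  define U where "U c = dest_backlog w Q0 (Z c t)" for c
  \<comment> \<open>the share of class \<open>c\<close> in the quantity that backpressure maximizes\<close>
  define pressure where "pressure x c =
      (\<Sum>n | n \<noteq> dest G c. Q c n t * (outflow G (x c) n - inflow G (x c) n))
      - U c * inflow G (x c) (dest G c)" for x :: "'c \<Rightarrow> 'n \<times> 'n \<Rightarrow> real" and c
  let ?W = "diff_backlog G w Q0 (\<lambda>c n. Q c n t) (\<lambda>c. Z c t)"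
  have pressure: "(\<Sum>c\<in>UNIV. pressure x c) = (\<Sum>l\<in>links G. \<Sum>c\<in>UNIV. x c l * ?W l c)"
    if "\<And>c l. l \<in> links G \<Longrightarrow> c \<notin> access G l \<Longrightarrow> x c l = 0" for x
  proof -
    have "pressure x c = (\<Sum>l\<in>links G. x c l * ?W l c)" for c
      unfolding pressure_def U_def using sum_diff_backlog[OF net that] by simp
    then show ?thesis
      by (simp add: sum.swap[of _ "links G"])
  qed
  have "(\<Sum>c\<in>UNIV. pressure f c) = (\<Sum>l\<in>links G. \<Sum>c\<in>UNIV. f c l * ?W l c)"
    by (rule pressure) (rule f(2))
  also have "\<dots> \<le> (\<Sum>l\<in>links G. \<Sum>c\<in>UNIV. \<mu> c l t * ?W l c)"
    by (rule sum_mono, rule backpressure_maximizes[OF mu]) (use f in auto)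
  also have "\<dots> = (\<Sum>c\<in>UNIV. pressure (\<lambda>c l. \<mu> c l t) c)"
    by (rule pressure[symmetric]) (rule mu_rates(3))
  also have "(\<Sum>c\<in>UNIV. pressure f c)
      = (\<Sum>c\<in>UNIV. (\<Sum>n | n \<noteq> dest G c. Q c n t * (lam c n - q c n)) - U c * r c)"
    unfolding pressure_def f_dest by (intro sum.cong arg_cong2[of _ _ _ _ minus]) (auto simp: net_out)
  finally have routing:
    "(\<Sum>c\<in>UNIV. (\<Sum>n | n \<noteq> dest G c. Q c n t * (lam c n - q c n)) - U c * r c)
      \<le> (\<Sum>c\<in>UNIV. pressure (\<lambda>c l. \<mu> c l t) c)" .

  let ?BQ = "(mu_out_max G + d_max)\<^sup>2 + (A_max + mu_in_max G)\<^sup>2 + 2 * d_max\<^sup>2"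
  let ?BZ = "exp (w * (\<nu>_max + mu_in_max G)) + w * \<epsilon> / 2 * exp (w * Q0) + exp (w * Q0)"
  define L where "L c s = (\<Sum>n | n \<noteq> dest G c. ((Q c n s)\<^sup>2 + (D c n s)\<^sup>2) / 2)
     + exp (w * \<bar>Z c s - Q0\<bar>)" for c s

  have class_drift: "L c (Suc t) + V * (\<theta> c * (\<Sum>n | n \<noteq> dest G c. \<phi> c n t))
        - V * (g c (\<nu> c t) - \<theta> c * \<nu> c t)
      \<le> L c t + (real CARD('n) * ?BQ + ?BZ) - pressure (\<lambda>c l. \<mu> c l t) c
        + (\<Sum>n | n \<noteq> dest G c. Q c n t * A c n t) - (\<Sum>n | n \<noteq> dest G c. Q c n t * q c n)
        + V * (\<theta> c * (\<Sum>n | n \<noteq> dest G c. q c n))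
        - V * (g c (r c + \<epsilon> / 2) - \<theta> c * (r c + \<epsilon> / 2)) - U c * r c" for c
  proof -
    let ?S = "{n. n \<noteq> dest G c}"
    have node: "((Q c n (Suc t))\<^sup>2 + (D c n (Suc t))\<^sup>2) / 2 + V * \<theta> c * \<phi> c n t
        \<le> ((Q c n t)\<^sup>2 + (D c n t)\<^sup>2) / 2 + ?BQ
          - Q c n t * (outflow G (\<lambda>l. \<mu> c l t) n - inflow G (\<lambda>l. \<mu> c l t) n)
          + Q c n t * A c n t - Q c n t * q c n + V * \<theta> c * q c n" if n: "n \<in> ?S" for n
    proof -
      have n': "n \<noteq> dest G c"
        using n by simp
      \<comment> \<open>the bang-bang rules for \<open>d\<close> and \<open>\<phi>\<close> beat any rate in \<open>[0, d_max]\<close>, in particular \<open>q\<close>\<close>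
      have "(Q c n t - D c n t) * q c n \<le> (Q c n t - D c n t) * d c n t"
        using d[OF n', of t] q[OF n'] q_le[OF n']
        by (auto intro: mult_left_mono mult_nonpos_nonneg)
      moreover have "(D c n t - V * \<theta> c) * q c n \<le> (D c n t - V * \<theta> c) * \<phi> c n t"
        using phi[OF n', of t] q[OF n'] q_le[OF n']
        by (auto intro: mult_left_mono mult_nonpos_nonneg)
      ultimately show ?thesis
        using node_drift[OF n', of t] by (simp add: algebra_simps)
    qed
    have "(\<Sum>n\<in>?S. ((Q c n (Suc t))\<^sup>2 + (D c n (Suc t))\<^sup>2) / 2 + V * \<theta> c * \<phi> c n t)
        \<le> (\<Sum>n\<in>?S. ((Q c n t)\<^sup>2 + (D c n t)\<^sup>2) / 2 + ?BQ
          - Q c n t * (outflow G (\<lambda>l. \<mu> c l t) n - inflow G (\<lambda>l. \<mu> c l t) n)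
          + Q c n t * A c n t - Q c n t * q c n + V * \<theta> c * q c n)"
      by (rule sum_mono) (rule node)
    then have nodes: "(\<Sum>n\<in>?S. ((Q c n (Suc t))\<^sup>2 + (D c n (Suc t))\<^sup>2) / 2)
          + V * \<theta> c * (\<Sum>n\<in>?S. \<phi> c n t)
        \<le> (\<Sum>n\<in>?S. ((Q c n t)\<^sup>2 + (D c n t)\<^sup>2) / 2) + real (card ?S) * ?BQ
          - (\<Sum>n\<in>?S. Q c n t * (outflow G (\<lambda>l. \<mu> c l t) n - inflow G (\<lambda>l. \<mu> c l t) n))
          + (\<Sum>n\<in>?S. Q c n t * A c n t) - (\<Sum>n\<in>?S. Q c n t * q c n)
          + V * \<theta> c * (\<Sum>n\<in>?S. q c n)"
      by (simp only: sum.distrib sum_subtractf sum_distrib_left sum_constant distrib_left)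
    have card: "real (card ?S) * ?BQ \<le> real CARD('n) * ?BQ"
      by (intro mult_right_mono) (auto intro: card_mono)
    have "V * (g c (r c + \<epsilon> / 2) - \<theta> c * (r c + \<epsilon> / 2)) + (r c + \<epsilon> / 2) * U c
        \<le> V * (g c (\<nu> c t) - \<theta> c * \<nu> c t) + \<nu> c t * U c"
      unfolding U_def using r_nonneg[of c] eps r_le[of c] by (intro nu_optimal) auto
    then show ?thesis
      using nodes card virtual_queue_drift[of c t]
      unfolding L_def pressure_def U_def[symmetric] by (simp add: algebra_simps)
  qed
  have "(\<Sum>c\<in>UNIV. L c (Suc t) + V * (\<theta> c * (\<Sum>n | n \<noteq> dest G c. \<phi> c n t))
        - V * (g c (\<nu> c t) - \<theta> c * \<nu> c t))
      \<le> (\<Sum>c\<in>UNIV. L c t + (real CARD('n) * ?BQ + ?BZ) - pressure (\<lambda>c l. \<mu> c l t) c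
        + (\<Sum>n | n \<noteq> dest G c. Q c n t * A c n t) - (\<Sum>n | n \<noteq> dest G c. Q c n t * q c n)
        + V * (\<theta> c * (\<Sum>n | n \<noteq> dest G c. q c n))
        - V * (g c (r c + \<epsilon> / 2) - \<theta> c * (r c + \<epsilon> / 2)) - U c * r c)"
    by (intro sum_mono class_drift)
  also have "\<dots> = (\<Sum>c\<in>UNIV. L c t) + real CARD('c) * (real CARD('n) * ?BQ + ?BZ)
        - (\<Sum>c\<in>UNIV. pressure (\<lambda>c l. \<mu> c l t) c)
        + (\<Sum>c\<in>UNIV. \<Sum>n | n \<noteq> dest G c. Q c n t * A c n t)
        - (\<Sum>c\<in>UNIV. \<Sum>n | n \<noteq> dest G c. Q c n t * q c n)
        + V * (\<Sum>c\<in>UNIV. \<theta> c * (\<Sum>n | n \<noteq> dest G c. q c n))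
        - V * (\<Sum>c\<in>UNIV. g c (r c + \<epsilon> / 2) - \<theta> c * (r c + \<epsilon> / 2))
        - (\<Sum>c\<in>UNIV. U c * r c)"
    by (simp only: sum.distrib sum_subtractf sum_distrib_left sum_constant distrib_left
        right_diff_distrib)
  finally have "(\<Sum>c\<in>UNIV. L c (Suc t))
        + V * (\<Sum>c\<in>UNIV. \<theta> c * (\<Sum>n | n \<noteq> dest G c. \<phi> c n t))
        - V * (\<Sum>c\<in>UNIV. g c (\<nu> c t) - \<theta> c * \<nu> c t) \<le> \<dots>"
    by (simp only: sum.distrib sum_subtractf sum_distrib_left right_diff_distrib)
  moreover have "real CARD('c) * (real CARD('n) * ?BQ + ?BZ) = slot_constant"
    unfolding slot_constant_def by (simp only: distrib_left mult_ac)
  moreover have "(\<Sum>c\<in>UNIV. (\<Sum>n | n \<noteq> dest G c. Q c n t * (lam c n - q c n)) - U c * r c)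
      = (\<Sum>c\<in>UNIV. \<Sum>n | n \<noteq> dest G c. Q c n t * A c n t)
        - (\<Sum>c\<in>UNIV. \<Sum>n | n \<noteq> dest G c. Q c n t * (A c n t - lam c n))
        - (\<Sum>c\<in>UNIV. \<Sum>n | n \<noteq> dest G c. Q c n t * q c n) - (\<Sum>c\<in>UNIV. U c * r c)"
    by (simp add: sum_subtractf right_diff_distrib)
  ultimately show ?thesis
    using routing unfolding lyapunov_def L_def[symmetric] q_total by linarith
qed

subsection \<open>From admission and drop decisions to throughput\<close>

text \<open>Adding the update rules of \<open>Q\<close> and \<open>D\<close> eliminates the actual drops: whatever arrives is
  delivered, or removed from a drop queue by \<open>\<phi>\<close>, or still stored in one of the bounded queues.\<close>

lemma dropped_or_delivered:
  "(\<Sum>\<tau><T. \<Sum>n | n \<noteq> dest G c. \<phi> c n \<tau>)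
    \<ge> (\<Sum>\<tau><T. \<Sum>n | n \<noteq> dest G c. A c n \<tau>)
      - (\<Sum>\<tau><T. inflow G (\<lambda>l. mutil c l \<tau>) (dest G c))
      - real (card {n. n \<noteq> dest G c}) * (Q_bound c + d_max)"
proof -
  let ?S = "{n. n \<noteq> dest G c}"
  define X where "X t = (\<Sum>n\<in>?S. Q c n t + D c n t)" for t
  have "X (Suc \<tau>) - X \<tau> \<ge> (\<Sum>n\<in>?S. A c n \<tau>) - inflow G (\<lambda>l. mutil c l \<tau>) (dest G c)
      - (\<Sum>n\<in>?S. \<phi> c n \<tau>)" for \<tau>
  proof -
    have "(\<Sum>n\<in>?S. A c n \<tau> + (inflow G (\<lambda>l. mutil c l \<tau>) n - outflow G (\<lambda>l. mutil c l \<tau>) n)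
        - \<phi> c n \<tau>) \<le> (\<Sum>n\<in>?S. (Q c n (Suc \<tau>) + D c n (Suc \<tau>)) - (Q c n \<tau> + D c n \<tau>))"
      by (rule sum_mono) (auto simp: Q_step D_step max_def)
    then show ?thesis
      using sum_net_inflow[OF net, of c "\<lambda>l. mutil c l \<tau>"] mutil_rates(4)
      by (simp add: X_def sum.distrib sum_subtractf)
  qed
  then have "(\<Sum>\<tau><T. X (Suc \<tau>) - X \<tau>) \<ge> (\<Sum>\<tau><T. (\<Sum>n\<in>?S. A c n \<tau>)
      - inflow G (\<lambda>l. mutil c l \<tau>) (dest G c) - (\<Sum>n\<in>?S. \<phi> c n \<tau>))"
    by (intro sum_mono)
  moreover have "X T - X 0 \<le> real (card ?S) * (Q_bound c + d_max)"
  proof -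
    have "X T - X 0 = (\<Sum>n\<in>?S. (Q c n T + D c n T) - (Q c n 0 + D c n 0))"
      by (simp add: X_def sum_subtractf)
    also have "\<dots> \<le> (\<Sum>n\<in>?S. Q_bound c + d_max)"
    proof (rule sum_mono)
      fix n assume "n \<in> ?S"
      then show "(Q c n T + D c n T) - (Q c n 0 + D c n 0) \<le> Q_bound c + d_max"
        using Q_le[of n c T] D_bounds[of n c T] Q_init[of n c] D_init[of n c] by auto
    qed
    finally show ?thesis
      by simp
  qed
  ultimately show ?thesis
    unfolding sum_lessThan_telescope by (simp add: sum_subtractf)
qed

lemma delivered_le_admitted:
  "(\<Sum>\<tau><T. inflow G (\<lambda>l. mutil c l \<tau>) (dest G c)) \<le> (\<Sum>\<tau><T. \<nu> c \<tau>) + Z_bound c"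
proof -
  have "(\<Sum>\<tau><T. inflow G (\<lambda>l. mutil c l \<tau>) (dest G c) - \<nu> c \<tau>) \<le> (\<Sum>\<tau><T. Z c (Suc \<tau>) - Z c \<tau>)"
    by (intro sum_mono) (simp add: Z_step)
  also have "\<dots> \<le> Z_bound c"
    unfolding sum_lessThan_telescope using Z_le[of c T] by (simp add: Z_init)
  finally show ?thesis
    by (simp add: sum_subtractf)
qed

text \<open>Concavity is used twice, to average the utility of the admissions over time and to replace the
  utility of the delivered average by its tangent at \<open>x\<close>. The resulting bound is affine in the delivered
  amount \<open>S\<close>, so that its expectation only involves the expectation of \<open>S\<close>.\<close>

lemma admitted_utility_le:
  fixes c :: 'c
  assumes T: "T > 0" and x: "0 \<le> x"
  defines "S \<equiv> \<Sum>\<tau><T. inflow G (\<lambda>l. mutil c l \<tau>) (dest G c)"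
  shows "(\<Sum>\<tau><T. g c (\<nu> c \<tau>) - \<theta> c * \<nu> c \<tau>) + \<theta> c * S
    \<le> real T * (g c x - g' c x * x + m c * \<epsilon>) + g' c x * S + \<theta> c * Z_bound c"
proof -
  define N where "N = (\<Sum>\<tau><T. \<nu> c \<tau>)"
  have S: "0 \<le> S"
    unfolding S_def by (intro sum_nonneg) (simp add: flow_bounds)
  have N: "0 \<le> N"
    unfolding N_def by (intro sum_nonneg) (simp add: nu_range)
  have Zb: "0 \<le> Z_bound c"
    using Z_le[of c 0] by (simp add: Z_init)
  have "(\<Sum>\<tau><T. g c (\<nu> c \<tau>)) \<le> (\<Sum>\<tau><T. g c (N / T) + g' c (N / T) * (\<nu> c \<tau> - N / T))"
    using N nu_range by (intro sum_mono utility_tangent) auto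
  also have "\<dots> = T * g c (N / T) + g' c (N / T) * (N - T * (N / T))"
    by (simp add: sum.distrib sum_subtractf N_def flip: sum_distrib_left)
  also have "\<dots> = T * g c (N / T)"
    using T by simp
  finally have jensen: "(\<Sum>\<tau><T. g c (\<nu> c \<tau>)) \<le> T * g c (N / T)" .
  have "S / T \<le> N / T + Z_bound c / T"
    using delivered_le_admitted[where c = c and T = T] T
    unfolding S_def[symmetric] N_def[symmetric] by (simp add: field_simps)
  then have "g c (N / T) - \<theta> c * (N / T - S / T)
      \<le> g c (S / T) + m c * \<epsilon> + \<theta> c * (Z_bound c / T)"
    using S N Zb by (intro admission_gap) auto
  also have "g c (S / T) \<le> g c x + g' c x * (S / T - x)"
    using S x by (intro utility_tangent) auto
  finally have "T * (g c (N / T) - \<theta> c * (N / T - S / T))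
      \<le> T * (g c x + g' c x * (S / T - x) + m c * \<epsilon> + \<theta> c * (Z_bound c / T))"
    by (simp add: mult_left_mono)
  moreover have "(\<Sum>\<tau><T. g c (\<nu> c \<tau>) - \<theta> c * \<nu> c \<tau>) = (\<Sum>\<tau><T. g c (\<nu> c \<tau>)) - \<theta> c * N"
    by (simp add: sum_subtractf N_def flip: sum_distrib_left)
  moreover have "T * (g c (N / T) - \<theta> c * (N / T - S / T))
      = T * g c (N / T) - \<theta> c * N + \<theta> c * S"
    using T by (simp add: algebra_simps)
  moreover have "T * (g c x + g' c x * (S / T - x) + m c * \<epsilon> + \<theta> c * (Z_bound c / T))
      = T * (g c x - g' c x * x + m c * \<epsilon>) + g' c x * S + \<theta> c * Z_bound c"
    using T by (simp add: algebra_simps)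
  ultimately show ?thesis
    using jensen by linarith
qed

lemma lyapunov_nonneg: "0 \<le> lyapunov t"
  unfolding lyapunov_def by (intro sum_nonneg add_nonneg_nonneg) auto

lemma lyapunov_init:
  "lyapunov 0 = (\<Sum>c\<in>UNIV. real (card {n. n \<noteq> dest G c}) * ((V * \<theta> c)\<^sup>2 / 2) + exp (w * Q0))"
  unfolding lyapunov_def
proof (rule sum.cong[OF refl])
  fix c
  have "(\<Sum>n | n \<noteq> dest G c. ((Q c n 0)\<^sup>2 + (D c n 0)\<^sup>2) / 2)
      = (\<Sum>n | n \<noteq> dest G c. (V * \<theta> c)\<^sup>2 / 2)"
    by (intro sum.cong) (auto simp: Q_init D_init)
  then show "(\<Sum>n | n \<noteq> dest G c. ((Q c n 0)\<^sup>2 + (D c n 0)\<^sup>2) / 2) + exp (w * \<bar>Z c 0 - Q0\<bar>)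
      = real (card {n. n \<noteq> dest G c}) * ((V * \<theta> c)\<^sup>2 / 2) + exp (w * Q0)"
    using nu_max Q0 by (simp add: Z_init)
qed

text \<open>The slot inequality summed over \<open>T\<close> slots. The Lyapunov function telescopes, the penalties are
  translated into deliveries by \<open>dropped_or_delivered\<close> and \<open>admitted_utility_le\<close>, and the total arrivals
  appearing on both sides differ by a second fluctuation term, with weights \<open>\<theta>\<close>. Both fluctuations have
  mean \<open>0\<close> once \<open>lam\<close> is the arrival rate.\<close>

lemma pathwise_utility_bound:
  assumes r: "r \<in> throughput_region G lam"
    and lam: "\<And>c n. 0 \<le> lam c n" "\<And>c n. lam c n \<le> A_max"
    and r_le: "\<And>c. r c + \<epsilon> / 2 \<le> \<nu>_max"
    and T: "T > 0" and x: "\<And>c. 0 \<le> x c"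
  shows "real T * ((\<Sum>c\<in>UNIV. g c (r c)) - slot_constant / V
        - \<epsilon> * (\<Sum>c\<in>UNIV. m c) - \<epsilon> / 2 * (\<Sum>c\<in>UNIV. \<theta> c)) - overhead
      - (\<Sum>\<tau><T. \<Sum>c\<in>UNIV. \<Sum>n | n \<noteq> dest G c. Q c n \<tau> * (A c n \<tau> - lam c n)) / V
      + (\<Sum>c\<in>UNIV. \<theta> c * (\<Sum>\<tau><T. \<Sum>n | n \<noteq> dest G c. A c n \<tau> - lam c n))
    \<le> (\<Sum>c\<in>UNIV. real T * (g c (x c) - g' c (x c) * x c)
        + g' c (x c) * (\<Sum>\<tau><T. inflow G (\<lambda>l. mutil c l \<tau>) (dest G c)))"
proof -
  let ?S = "\<lambda>c. {n. n \<noteq> dest G c}"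
  define del where "del c = (\<Sum>\<tau><T. inflow G (\<lambda>l. mutil c l \<tau>) (dest G c))" for c
  define \<Phi> where "\<Phi> c = (\<Sum>\<tau><T. \<Sum>n\<in>?S c. \<phi> c n \<tau>)" for c
  define H where "H c = (\<Sum>\<tau><T. g c (\<nu> c \<tau>) - \<theta> c * \<nu> c \<tau>)" for c
  define \<Lambda> where "\<Lambda> c = (\<Sum>n\<in>?S c. lam c n)" for c
  define arr where "arr c = (\<Sum>\<tau><T. \<Sum>n\<in>?S c. A c n \<tau>)" for c
  define noise where
    "noise = (\<Sum>\<tau><T. \<Sum>c\<in>UNIV. \<Sum>n\<in>?S c. Q c n \<tau> * (A c n \<tau> - lam c n))"
  define Y where "Y c = real T * (g c (x c) - g' c (x c) * x c) + g' c (x c) * del c" for c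

  \<comment> \<open>the penalties of the policy in slot \<open>\<tau>\<close>, and those of the reference policy\<close>
  define cost where "cost \<tau> = (\<Sum>c\<in>UNIV. \<theta> c * (\<Sum>n\<in>?S c. \<phi> c n \<tau>))" for \<tau>
  define gain where "gain \<tau> = (\<Sum>c\<in>UNIV. g c (\<nu> c \<tau>) - \<theta> c * \<nu> c \<tau>)" for \<tau>
  define cost' where "cost' = (\<Sum>c\<in>UNIV. \<theta> c * (\<Lambda> c - r c))"
  define gain' where "gain' = (\<Sum>c\<in>UNIV. g c (r c + \<epsilon> / 2) - \<theta> c * (r c + \<epsilon> / 2))"
  have "(\<Sum>\<tau><T. (lyapunov (Suc \<tau>) - lyapunov \<tau>) + V * (cost \<tau> - gain \<tau>))
      \<le> (\<Sum>\<tau><T. (slot_constant + V * (cost' - gain'))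
        + (\<Sum>c\<in>UNIV. \<Sum>n\<in>?S c. Q c n \<tau> * (A c n \<tau> - lam c n)))"
  proof (rule sum_mono)
    fix \<tau>
    show "(lyapunov (Suc \<tau>) - lyapunov \<tau>) + V * (cost \<tau> - gain \<tau>)
      \<le> (slot_constant + V * (cost' - gain'))
        + (\<Sum>c\<in>UNIV. \<Sum>n\<in>?S c. Q c n \<tau> * (A c n \<tau> - lam c n))"
      using slot_drift[OF r lam r_le, of \<tau>]
      unfolding \<Lambda>_def cost_def gain_def cost'_def gain'_def right_diff_distrib[of V] by linarith
  qed
  then have "lyapunov T - lyapunov 0 + V * ((\<Sum>\<tau><T. cost \<tau>) - (\<Sum>\<tau><T. gain \<tau>))
      \<le> T * (slot_constant + V * (cost' - gain')) + noise"
    unfolding sum.distrib sum_lessThan_telescope sum_distrib_left[symmetric] sum_subtractf[of cost]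
      noise_def[symmetric] by (simp add: distrib_left mult.left_commute)
  moreover have "(\<Sum>\<tau><T. cost \<tau>) = (\<Sum>c\<in>UNIV. \<theta> c * \<Phi> c)"
    unfolding cost_def \<Phi>_def sum_distrib_left by (rule sum.swap)
  moreover have "(\<Sum>\<tau><T. gain \<tau>) = (\<Sum>c\<in>UNIV. H c)"
    unfolding gain_def H_def by (rule sum.swap)
  ultimately have "lyapunov T - lyapunov 0 + V * ((\<Sum>c\<in>UNIV. \<theta> c * \<Phi> c) - (\<Sum>c\<in>UNIV. H c))
      \<le> T * (slot_constant + V * (cost' - gain')) + noise"
    by simp
  then have "V * ((\<Sum>c\<in>UNIV. \<theta> c * \<Phi> c) - (\<Sum>c\<in>UNIV. H c))
      \<le> V * (lyapunov 0 / V + T * (slot_constant / V) + noise / V + T * (cost' - gain'))"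
    using lyapunov_nonneg[of T] V_pos by (simp add: algebra_simps)
  then have "(\<Sum>c\<in>UNIV. \<theta> c * \<Phi> c) - (\<Sum>c\<in>UNIV. H c)
      \<le> lyapunov 0 / V + T * (slot_constant / V) + noise / V + T * (cost' - gain')"
    using V_pos by simp
  then have total: "(\<Sum>c\<in>UNIV. \<theta> c * \<Phi> c - H c - T * (\<theta> c * (\<Lambda> c - r c))
        + T * (g c (r c + \<epsilon> / 2) - \<theta> c * (r c + \<epsilon> / 2)))
      \<le> lyapunov 0 / V + T * (slot_constant / V) + noise / V"
    unfolding cost'_def gain'_def sum.distrib sum_subtractf[of _ _ UNIV] sum_distrib_left[symmetric]
    by (simp add: sum_subtractf algebra_simps)

  have r_nonneg: "0 \<le> r c" for c
    using r by (simp add: throughput_region_def)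
  have "(\<Sum>c\<in>UNIV. \<theta> c * (arr c - T * \<Lambda> c) + T * (g c (r c) - \<epsilon> * m c - \<epsilon> / 2 * \<theta> c)
        - \<theta> c * (real (card (?S c)) * (Q_bound c + d_max) + Z_bound c) - Y c)
      \<le> (\<Sum>c\<in>UNIV. \<theta> c * \<Phi> c - H c - T * (\<theta> c * (\<Lambda> c - r c))
        + T * (g c (r c + \<epsilon> / 2) - \<theta> c * (r c + \<epsilon> / 2)))"
  proof (rule sum_mono)
    fix c
    have "\<theta> c * (arr c - del c - real (card (?S c)) * (Q_bound c + d_max)) \<le> \<theta> c * \<Phi> c"
      using dropped_or_delivered[where c = c and T = T] theta_pos[of c]
      unfolding arr_def del_def \<Phi>_def by (intro mult_left_mono) auto
    moreover have "H c + \<theta> c * del c \<le> Y c + T * (m c * \<epsilon>) + \<theta> c * Z_bound c"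
      using admitted_utility_le[OF T x, of c c] unfolding H_def del_def Y_def
      by (simp add: algebra_simps)
    moreover have "T * g c (r c) \<le> T * g c (r c + \<epsilon> / 2)"
      using g_incr[of c] r_nonneg[of c] eps by (intro mult_left_mono) (auto intro: mono_onD)
    ultimately show "\<theta> c * (arr c - T * \<Lambda> c) + T * (g c (r c) - \<epsilon> * m c - \<epsilon> / 2 * \<theta> c)
        - \<theta> c * (real (card (?S c)) * (Q_bound c + d_max) + Z_bound c) - Y c
      \<le> \<theta> c * \<Phi> c - H c - T * (\<theta> c * (\<Lambda> c - r c))
        + T * (g c (r c + \<epsilon> / 2) - \<theta> c * (r c + \<epsilon> / 2))"
      by (simp add: algebra_simps)
  qed
  also note total
  finally have "(\<Sum>c\<in>UNIV. \<theta> c * (arr c - T * \<Lambda> c))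
        + (\<Sum>c\<in>UNIV. T * (g c (r c) - \<epsilon> * m c - \<epsilon> / 2 * \<theta> c))
        - (\<Sum>c\<in>UNIV. \<theta> c * (real (card (?S c)) * (Q_bound c + d_max) + Z_bound c))
        - (\<Sum>c\<in>UNIV. Y c)
      \<le> lyapunov 0 / V + T * (slot_constant / V) + noise / V"
    by (simp only: sum.distrib sum_subtractf)
  moreover have "(\<Sum>c\<in>UNIV. T * (g c (r c) - \<epsilon> * m c - \<epsilon> / 2 * \<theta> c))
      = T * ((\<Sum>c\<in>UNIV. g c (r c)) - \<epsilon> * (\<Sum>c\<in>UNIV. m c) - \<epsilon> / 2 * (\<Sum>c\<in>UNIV. \<theta> c))"
    by (simp only: sum_subtractf sum_distrib_left right_diff_distrib)
  moreover have "arr c - T * \<Lambda> c = (\<Sum>\<tau><T. \<Sum>n\<in>?S c. A c n \<tau> - lam c n)" for c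
    by (simp add: arr_def \<Lambda>_def sum_subtractf)
  ultimately show ?thesis
    unfolding overhead_def lyapunov_init Y_def del_def noise_def
    by (simp add: algebra_simps)
qed

end

section \<open>Expected utility\<close>

lemma (in prob_space) expectation_mult_indep_algebras:
  fixes X Y :: "'a \<Rightarrow> real"
  assumes indep: "indep_set (sets N) (sets N')"
    and N: "space N = space M" "X \<in> borel_measurable N"
    and N': "space N' = space M" "Y \<in> borel_measurable N'"
    and int: "integrable M X" "integrable M Y"
  shows "integrable M (\<lambda>\<omega>. X \<omega> * Y \<omega>)"
    "expectation (\<lambda>\<omega>. X \<omega> * Y \<omega>) = expectation X * expectation Y"
proof -
  have gen: "sigma_sets (space M) {f -` A \<inter> space M | A. A \<in> sets borel} \<subseteq> sets K"
    if "space K = space M" "f \<in> borel_measurable K" for K and f :: "'a \<Rightarrow> real"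
    unfolding that(1)[symmetric] using that(2) by (intro sets.sigma_sets_subset) auto
  have "indep_set (sigma_sets (space M) {X -` A \<inter> space M | A. A \<in> sets borel})
      (sigma_sets (space M) {Y -` A \<inter> space M | A. A \<in> sets borel})"
    using indep gen[OF N] gen[OF N'] unfolding indep_set_def
    by (elim indep_sets_mono_sets) (auto split: bool.split)
  then have "indep_var borel X borel Y"
    unfolding indep_var_eq using int by auto
  then show "integrable M (\<lambda>\<omega>. X \<omega> * Y \<omega>)"
    "expectation (\<lambda>\<omega>. X \<omega> * Y \<omega>) = expectation X * expectation Y"
    using indep_var_integrable indep_var_lebesgue_integral int by blast+
qed

theorem theorem2:
  fixes M :: "'w measure"
    and F :: "nat \<Rightarrow> 'w measure"
    and G :: "('n::finite, 'c::finite) network"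
    and A :: "'c \<Rightarrow> 'n \<Rightarrow> nat \<Rightarrow> 'w \<Rightarrow> nat"
    and A_max :: nat
    and lam :: "'c \<Rightarrow> 'n \<Rightarrow> real"
    and Q D d \<phi> dtil :: "'c \<Rightarrow> 'n \<Rightarrow> nat \<Rightarrow> 'w \<Rightarrow> real"
    and \<mu> mutil :: "'c \<Rightarrow> 'n \<times> 'n \<Rightarrow> nat \<Rightarrow> 'w \<Rightarrow> real"
    and Z \<nu> :: "'c \<Rightarrow> nat \<Rightarrow> 'w \<Rightarrow> real"
    and g g' :: "'c \<Rightarrow> real \<Rightarrow> real"
    and m \<theta> rstar rbar :: "'c \<Rightarrow> real"
    and d_max \<epsilon> \<nu>_max \<delta>_max w Q0 V B1 :: real
  assumes prob: "prob_space M"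
    and net: "valid_network G"
    \<comment> \<open>arrivals\<close>
    and A_meas: "\<And>c n t. A c n t \<in> measurable M (count_space UNIV)"
    and A_bound: "\<And>c n t \<omega>. \<omega> \<in> space M \<Longrightarrow> A c n t \<omega> \<le> A_max"
    and A_dest: "\<And>c t \<omega>. \<omega> \<in> space M \<Longrightarrow> A c (dest G c) t \<omega> = 0"
    and A_indep: "prob_space.indep_vars M (\<lambda>_. count_space UNIV) (\<lambda>(c, n, t). A c n t)
                    {(c, n, t). n \<noteq> dest G c}"
    and A_ident: "\<And>c n t. distr M (count_space UNIV) (A c n t) = distr M (count_space UNIV) (A c n 0)"
    and A_mean: "\<And>c n t. prob_space.expectation M (\<lambda>\<omega>. real (A c n t \<omega>)) = lam c n"
    \<comment> \<open>causality: \<open>F t\<close> is the information available at the beginning of slot \<open>t\<close>\<close>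
    and filt: "filtration (space M) F" "\<And>t. subalgebra M (F t)"
    and A_adapted: "\<And>c n t. A c n t \<in> measurable (F (Suc t)) (count_space UNIV)"
    and A_fresh: "\<And>t. prob_space.indep_set M (sets (F t))
                    (sets (vimage_algebra (space M) (\<lambda>\<omega> (c, n). A c n t \<omega>)
                      (Pi\<^sub>M UNIV (\<lambda>_. count_space UNIV))))"
    and mu_adapted: "\<And>c l t. l \<in> links G \<Longrightarrow> \<mu> c l t \<in> borel_measurable (F t)"
    and nu_adapted: "\<And>c t. \<nu> c t \<in> borel_measurable (F t)"
    and mutil_adapted: "\<And>c l t. l \<in> links G \<Longrightarrow> mutil c l t \<in> borel_measurable (F (Suc t))"
    \<comment> \<open>utilities\<close>
    and g_concave: "\<And>c. concave_on {0..} (g c)"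
    and g_incr: "\<And>c. mono_on {0..} (g c)"
    and g_deriv: "\<And>c x. x \<ge> 0 \<Longrightarrow> (g c has_real_derivative g' c x) (at x within {0..})"
    and g'_cont: "\<And>c. continuous_on {0..} (g' c)"
    and g'_bound: "\<And>c x. x \<ge> 0 \<Longrightarrow> \<bar>g' c x\<bar> \<le> m c"
    \<comment> \<open>utility maximization problem\<close>
    and rstar: "is_arg_max (\<lambda>r. \<Sum>c\<in>UNIV. g c (r c)) (\<lambda>r. r \<in> throughput_region G lam) rstar"
    \<comment> \<open>parameters\<close>
    and d_max: "d_max \<ge> real A_max + mu_in_max G"
    and eps: "\<epsilon> > 0"
    and nu_max: "\<nu>_max \<ge> (MAX c. rstar c) + \<epsilon> / 2"
    and delta_max: "\<delta>_max = max \<nu>_max (mu_in_max G)"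
    and w: "w = \<epsilon> / \<delta>_max\<^sup>2 * exp (- \<epsilon> / \<delta>_max)"
    and Q0: "Q0 \<ge> \<nu>_max"
    and theta_pos: "\<And>c. \<theta> c > 0"
    and theta: "\<And>c x. x \<ge> \<epsilon> \<Longrightarrow> g' c x - \<theta> c \<le> 0"
    and V_pos: "V > 0"
    and V: "\<And>c. V * \<theta> c + 2 * d_max \<ge> w"
    and B1: "B1 = real CARD('n) * real CARD('c) *
                 ((mu_out_max G + d_max)\<^sup>2 + (real A_max + mu_in_max G)\<^sup>2 + 2 * d_max\<^sup>2)
               + real CARD('c) *
                 (w * (2 * \<delta>_max + \<epsilon>) + exp (w * (\<nu>_max + mu_in_max G))
                  + w * \<epsilon> / 2 * exp (w * Q0) + exp (w * Q0))"
    \<comment> \<open>packet dropping\<close>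
    and d: "\<And>c n t \<omega>. \<omega> \<in> space M \<Longrightarrow> n \<noteq> dest G c \<Longrightarrow>
              d c n t \<omega> = (if Q c n t \<omega> > D c n t \<omega> then d_max else 0)"
    and phi: "\<And>c n t \<omega>. \<omega> \<in> space M \<Longrightarrow> n \<noteq> dest G c \<Longrightarrow>
              \<phi> c n t \<omega> = (if D c n t \<omega> > V * \<theta> c then d_max else 0)"
    and dtil: "\<And>c n t \<omega>. \<omega> \<in> space M \<Longrightarrow> n \<noteq> dest G c \<Longrightarrow>
              dtil c n t \<omega>
                = min (max (Q c n t \<omega> - outflow G (\<lambda>l. \<mu> c l t \<omega>) n) 0) (d c n t \<omega>)"
    \<comment> \<open>backpressure routing and actual transmissions\<close>
    and mu: "\<And>t \<omega>. \<omega> \<in> space M \<Longrightarrow>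
              backpressure G (diff_backlog G w Q0 (\<lambda>c n. Q c n t \<omega>) (\<lambda>c. Z c t \<omega>))
                (\<lambda>c l. \<mu> c l t \<omega>)"
    and mutil_bounds: "\<And>c l t \<omega>. \<omega> \<in> space M \<Longrightarrow> l \<in> links G \<Longrightarrow>
              0 \<le> mutil c l t \<omega> \<and> mutil c l t \<omega> \<le> \<mu> c l t \<omega>"
    and mutil_total: "\<And>c n t \<omega>. \<omega> \<in> space M \<Longrightarrow> n \<noteq> dest G c \<Longrightarrow>
              outflow G (\<lambda>l. mutil c l t \<omega>) n
                = min (Q c n t \<omega>) (outflow G (\<lambda>l. \<mu> c l t \<omega>) n)"
    \<comment> \<open>receiver-based flow control\<close>
    and nu: "\<And>c t \<omega>. \<omega> \<in> space M \<Longrightarrow>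
              is_arg_max (\<lambda>x. V * (g c x - \<theta> c * x) + x * dest_backlog w Q0 (Z c t \<omega>))
                (\<lambda>x. 0 \<le> x \<and> x \<le> \<nu>_max) (\<nu> c t \<omega>)"
    \<comment> \<open>queue dynamics\<close>
    and Q_init: "\<And>c n \<omega>. \<omega> \<in> space M \<Longrightarrow> n \<noteq> dest G c \<Longrightarrow> Q c n 0 \<omega> = 0"
    and Q_step: "\<And>c n t \<omega>. \<omega> \<in> space M \<Longrightarrow> n \<noteq> dest G c \<Longrightarrow>
              Q c n (Suc t) \<omega> = Q c n t \<omega> - outflow G (\<lambda>l. mutil c l t \<omega>) n - dtil c n t \<omega>
                + real (A c n t \<omega>) + inflow G (\<lambda>l. mutil c l t \<omega>) n"
    and D_init: "\<And>c n \<omega>. \<omega> \<in> space M \<Longrightarrow> n \<noteq> dest G c \<Longrightarrow> D c n 0 \<omega> = V * \<theta> c"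
    and D_step: "\<And>c n t \<omega>. \<omega> \<in> space M \<Longrightarrow> n \<noteq> dest G c \<Longrightarrow>
              D c n (Suc t) \<omega> = max (D c n t \<omega> - \<phi> c n t \<omega>) 0 + dtil c n t \<omega>"
    and Z_init: "\<And>c \<omega>. \<omega> \<in> space M \<Longrightarrow> Z c 0 \<omega> = 0"
    and Z_step: "\<And>c t \<omega>. \<omega> \<in> space M \<Longrightarrow>
              Z c (Suc t) \<omega> = max (Z c t \<omega> - \<nu> c t \<omega>) 0
                + inflow G (\<lambda>l. mutil c l t \<omega>) (dest G c)"
    \<comment> \<open>limiting throughput\<close>
    and rbar: "\<And>c. (\<lambda>t. (1 / real t) * (\<Sum>\<tau><t. prob_space.expectation M
                 (\<lambda>\<omega>. inflow G (\<lambda>l. mutil c l \<tau> \<omega>) (dest G c)))) \<longlonglongrightarrow> rbar c"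
  shows "(\<Sum>c\<in>UNIV. g c (rbar c))
           \<ge> (\<Sum>c\<in>UNIV. g c (rstar c)) - B1 / V - 3 * \<epsilon> / 2 * (\<Sum>c\<in>UNIV. m c + \<theta> c)"
proof -
  interpret prob_space M by (fact prob)
  have space_F: "space (F t) = space M" for t
    using filt(2)[of t] by (simp add: subalgebra_def)
  have F_mono: "sets (F t) \<subseteq> sets (F (Suc t))" for t
    by (rule filtration.sets_F_mono[OF filt(1)]) simp
  have measurable_F_Suc: "X \<in> borel_measurable (F (Suc t))" if "X \<in> borel_measurable (F t)"
    for X :: "'w \<Rightarrow> real" and t
    by (rule measurable_from_subalg[OF _ that]) (simp add: subalgebra_def space_F F_mono)
  have measurable_M: "X \<in> borel_measurable M" if "X \<in> borel_measurable (F t)"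
    for X :: "'w \<Rightarrow> real" and t
    by (rule measurable_from_subalg[OF filt(2) that])

  have A_real: "(\<lambda>\<omega>. real (A c n t \<omega>)) \<in> borel_measurable M" for c n t
    using A_meas[of c n t] by measurable
  have A_int: "integrable M (\<lambda>\<omega>. real (A c n t \<omega>))" for c n t
    by (rule integrable_const_bound[where B = "real A_max"]) (use A_real A_bound in auto)
  have lam: "0 \<le> lam c n" "lam c n \<le> real A_max" for c n
  proof -
    show "0 \<le> lam c n"
      unfolding A_mean[of c n 0, symmetric] by (rule integral_nonneg_AE) simp
    have "expectation (\<lambda>\<omega>. real (A c n 0 \<omega>)) \<le> expectation (\<lambda>_. real A_max)"
      by (rule integral_mono[OF A_int]) (use A_bound in auto)
    then show "lam c n \<le> real A_max"
      by (simp add: A_mean prob_space)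
  qed

  have region: "rstar \<in> throughput_region G lam"
    using rstar by (simp add: is_arg_max_def)
  have rstar_nonneg: "0 \<le> rstar c" for c
    using region by (simp add: throughput_region_def)
  have rstar_le: "rstar c + \<epsilon> / 2 \<le> \<nu>_max" for c
  proof -
    have "rstar c \<le> (MAX c. rstar c)"
      by (rule Max_ge) auto
    with nu_max show ?thesis
      by linarith
  qed
  have nu_max_pos: "\<nu>_max > 0"
    using rstar_nonneg[of undefined] rstar_le[of undefined] eps by linarith

  interpret net: uora_network G "real A_max" d_max \<epsilon> \<nu>_max \<delta>_max w Q0 V \<theta> m g g'
  proof unfold_locales
    fix c x
    show "g' c x \<le> \<theta> c" if "\<epsilon> \<le> x"
      using theta[OF that, of c] by simp
  qed (use net d_max eps nu_max_pos delta_max w Q0 V_pos theta_pos g_concave g_incr g_deriv g'_bound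
      in auto)
  have path: "uora_path G (real A_max) d_max \<epsilon> \<nu>_max \<delta>_max w Q0 V \<theta> m g g'
      (\<lambda>c n t. real (A c n t \<omega>)) (\<lambda>c n t. Q c n t \<omega>) (\<lambda>c n t. D c n t \<omega>) (\<lambda>c n t. d c n t \<omega>)
      (\<lambda>c n t. \<phi> c n t \<omega>) (\<lambda>c n t. dtil c n t \<omega>) (\<lambda>c l t. \<mu> c l t \<omega>) (\<lambda>c l t. mutil c l t \<omega>)
      (\<lambda>c t. Z c t \<omega>) (\<lambda>c t. \<nu> c t \<omega>)" if "\<omega> \<in> space M" for \<omega>
    by unfold_locales
      ((rule d phi dtil mu mutil_bounds mutil_total nu Q_init Q_step D_init D_step Z_init Z_step;
        (assumption | rule that)) | simp add: A_bound[OF that])+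

  \<comment> \<open>Backlogs are known at the beginning of a slot. The drop queues are carried along in the induction
    because they determine the drop decision.\<close>
  have QD_meas: "Q c n t \<in> borel_measurable (F t) \<and> D c n t \<in> borel_measurable (F t)"
    if n: "n \<noteq> dest G c" for c n t
  proof (induction t)
    case 0
    have "Q c n 0 \<in> borel_measurable (F 0) \<longleftrightarrow> (\<lambda>_. 0::real) \<in> borel_measurable (F 0)"
      by (rule measurable_cong) (use Q_init[OF _ n] space_F in auto)
    moreover have "D c n 0 \<in> borel_measurable (F 0) \<longleftrightarrow> (\<lambda>_. V * \<theta> c) \<in> borel_measurable (F 0)"
      by (rule measurable_cong) (use D_init[OF _ n] space_F in auto)
    ultimately show ?case
      by simp
  next
    case (Suc t)
    then have [measurable]: "Q c n t \<in> borel_measurable (F t)" "D c n t \<in> borel_measurable (F t)"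
      by auto
    have out_mu: "(\<lambda>\<omega>. outflow G (\<lambda>l. \<mu> c l t \<omega>) n) \<in> borel_measurable (F t)"
      unfolding outflow_def by (intro borel_measurable_sum mu_adapted) auto
    define drop where "drop \<omega> = min (max (Q c n t \<omega> - outflow G (\<lambda>l. \<mu> c l t \<omega>) n) 0)
        (if Q c n t \<omega> > D c n t \<omega> then d_max else 0)" for \<omega>
    have drop[measurable]: "drop \<in> borel_measurable (F t)"
      unfolding drop_def using out_mu by measurable
    have drop_eq: "dtil c n t \<omega> = drop \<omega>" if "\<omega> \<in> space M" for \<omega>
      by (simp add: drop_def dtil[OF that n] d[OF that n])
    have "(\<lambda>\<omega>. max (D c n t \<omega> - (if D c n t \<omega> > V * \<theta> c then d_max else 0)) 0 + drop \<omega>)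
        \<in> borel_measurable (F t)"
      by measurable
    then have "(\<lambda>\<omega>. max (D c n t \<omega> - (if D c n t \<omega> > V * \<theta> c then d_max else 0)) 0 + drop \<omega>)
        \<in> borel_measurable (F (Suc t))"
      by (rule measurable_F_Suc)
    moreover have "D c n (Suc t) \<in> borel_measurable (F (Suc t)) \<longleftrightarrow>
        (\<lambda>\<omega>. max (D c n t \<omega> - (if D c n t \<omega> > V * \<theta> c then d_max else 0)) 0 + drop \<omega>)
        \<in> borel_measurable (F (Suc t))"
      by (rule measurable_cong) (use D_step[OF _ n] phi[OF _ n] drop_eq space_F in auto)
    ultimately have D: "D c n (Suc t) \<in> borel_measurable (F (Suc t))"
      by simp
    have "(\<lambda>\<omega>. Q c n t \<omega> - outflow G (\<lambda>l. mutil c l t \<omega>) n - drop \<omega>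
        + real (A c n t \<omega>) + inflow G (\<lambda>l. mutil c l t \<omega>) n) \<in> borel_measurable (F (Suc t))"
    proof (intro borel_measurable_add borel_measurable_diff)
      show "(\<lambda>\<omega>. outflow G (\<lambda>l. mutil c l t \<omega>) n) \<in> borel_measurable (F (Suc t))"
        "(\<lambda>\<omega>. inflow G (\<lambda>l. mutil c l t \<omega>) n) \<in> borel_measurable (F (Suc t))"
        unfolding outflow_def inflow_def by (intro borel_measurable_sum mutil_adapted; auto)+
      show "(\<lambda>\<omega>. real (A c n t \<omega>)) \<in> borel_measurable (F (Suc t))"
        using A_adapted[of c n t] by measurable
    qed (auto intro: measurable_F_Suc)
    moreover have "Q c n (Suc t) \<in> borel_measurable (F (Suc t)) \<longleftrightarrow>
        (\<lambda>\<omega>. Q c n t \<omega> - outflow G (\<lambda>l. mutil c l t \<omega>) n - drop \<omega>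
        + real (A c n t \<omega>) + inflow G (\<lambda>l. mutil c l t \<omega>) n) \<in> borel_measurable (F (Suc t))"
      by (rule measurable_cong) (use Q_step[OF _ n] drop_eq space_F in auto)
    ultimately show ?case
      using D by simp
  qed

  have A_vimage: "(\<lambda>\<omega>. real (A c n t \<omega>) - lam c n) \<in> borel_measurable
      (vimage_algebra (space M) (\<lambda>\<omega> (c, n). A c n t \<omega>) (Pi\<^sub>M UNIV (\<lambda>_. count_space UNIV)))"
    for c n t
  proof -
    have "(\<lambda>\<omega> (c, n). A c n t \<omega>) \<in> measurable
        (vimage_algebra (space M) (\<lambda>\<omega> (c, n). A c n t \<omega>) (Pi\<^sub>M UNIV (\<lambda>_. count_space UNIV)))
        (Pi\<^sub>M UNIV (\<lambda>_. count_space UNIV))"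
      by (rule measurable_vimage_algebra1) (auto simp: space_PiM)
    from measurable_compose[OF this measurable_component_singleton[of "(c, n)"]]
    have "A c n t \<in> measurable
        (vimage_algebra (space M) (\<lambda>\<omega> (c, n). A c n t \<omega>) (Pi\<^sub>M UNIV (\<lambda>_. count_space UNIV)))
        (count_space UNIV)"
      by simp
    then show ?thesis
      by measurable
  qed
  \<comment> \<open>The backlog at the beginning of a slot is independent of the arrivals in that slot.\<close>
  have noise: "integrable M (\<lambda>\<omega>. Q c n t \<omega> * (real (A c n t \<omega>) - lam c n))"
    "expectation (\<lambda>\<omega>. Q c n t \<omega> * (real (A c n t \<omega>) - lam c n)) = 0"
    if n: "n \<noteq> dest G c" for c n t
  proof -
    have Q_int: "integrable M (Q c n t)"
    proof (rule integrable_const_bound[where B = "net.Q_bound c"])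
      show "Q c n t \<in> borel_measurable M"
        by (rule measurable_M[OF conjunct1[OF QD_meas[OF n]]])
      show "AE \<omega> in M. norm (Q c n t \<omega>) \<le> net.Q_bound c"
        using uora_path.Q_le[OF path n] uora_path.Q_nonneg[OF path n] by auto
    qed
    have centred_int: "integrable M (\<lambda>\<omega>. real (A c n t \<omega>) - lam c n)"
      using A_int by simp
    have centred: "expectation (\<lambda>\<omega>. real (A c n t \<omega>) - lam c n) = 0"
      using A_int by (simp add: A_mean prob_space)
    note prod = expectation_mult_indep_algebras[OF A_fresh[of t] space_F
        conjunct1[OF QD_meas[OF n]] space_vimage_algebra A_vimage Q_int centred_int]
    show "integrable M (\<lambda>\<omega>. Q c n t \<omega> * (real (A c n t \<omega>) - lam c n))"
      by (rule prod(1))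
    show "expectation (\<lambda>\<omega>. Q c n t \<omega> * (real (A c n t \<omega>) - lam c n)) = 0"
      unfolding prod(2) centred by simp
  qed

  define del where "del c t \<omega> = inflow G (\<lambda>l. mutil c l t \<omega>) (dest G c)" for c t \<omega>
  have del_int: "integrable M (del c t)" for c t
  proof (rule integrable_const_bound[where B = "mu_in_max G"])
    show "del c t \<in> borel_measurable M"
      unfolding del_def inflow_def
      by (intro borel_measurable_sum measurable_M[OF mutil_adapted]) auto
    show "AE \<omega> in M. norm (del c t \<omega>) \<le> mu_in_max G"
      using uora_path.flow_bounds(1)[OF path] uora_path.inflow_mutil_le[OF path]
      by (auto simp: del_def)
  qed
  have del_nonneg: "0 \<le> expectation (del c t)" for c t
    unfolding del_def using uora_path.flow_bounds(1)[OF path]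
    by (intro integral_nonneg_AE) auto
  define avg where "avg c T = (1 / real T) * (\<Sum>\<tau><T. expectation (del c \<tau>))" for c T
  have avg_lim: "avg c \<longlonglongrightarrow> rbar c" for c
    using rbar[of c] unfolding avg_def[abs_def] del_def[abs_def] .
  have rbar_nonneg: "0 \<le> rbar c" for c
    using avg_lim[of c] by (rule LIMSEQ_le_const) (auto simp: avg_def intro!: exI[of _ 0] divide_nonneg_nonneg sum_nonneg del_nonneg)

  \<comment> \<open>The tangents are taken at the limit \<open>rbar\<close>, so that they become exact as \<open>T\<close> grows.\<close>
  define target where "target = (\<Sum>c\<in>UNIV. g c (rstar c)) - net.slot_constant / V
        - \<epsilon> * (\<Sum>c\<in>UNIV. m c) - \<epsilon> / 2 * (\<Sum>c\<in>UNIV. \<theta> c)"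
  have finite_horizon: "target - net.overhead / T
      \<le> (\<Sum>c\<in>UNIV. g c (rbar c) - g' c (rbar c) * rbar c + g' c (rbar c) * avg c T)"
    if T: "T > 0" for T :: nat
  proof -
    define N where "N \<omega> = (\<Sum>\<tau><T. \<Sum>c\<in>UNIV. \<Sum>n | n \<noteq> dest G c.
        Q c n \<tau> \<omega> * (real (A c n \<tau> \<omega>) - lam c n))" for \<omega>
    define R where "R \<omega> = (\<Sum>c\<in>UNIV. \<theta> c * (\<Sum>\<tau><T. \<Sum>n | n \<noteq> dest G c.
        real (A c n \<tau> \<omega>) - lam c n))" for \<omega>
    let ?lhs = "\<lambda>\<omega>. real T * target - net.overhead - N \<omega> / V + R \<omega>"
    let ?rhs = "\<lambda>\<omega>. \<Sum>c\<in>UNIV. real T * (g c (rbar c) - g' c (rbar c) * rbar c)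
        + g' c (rbar c) * (\<Sum>\<tau><T. del c \<tau> \<omega>)"
    have N: "integrable M N" "expectation N = 0"
    proof -
      show "integrable M N"
        unfolding N_def by (intro Bochner_Integration.integrable_sum noise(1)) auto
      have "expectation N = (\<Sum>\<tau><T. \<Sum>c\<in>UNIV. \<Sum>n | n \<noteq> dest G c.
          expectation (\<lambda>\<omega>. Q c n \<tau> \<omega> * (real (A c n \<tau> \<omega>) - lam c n)))"
        unfolding N_def
        by (subst Bochner_Integration.integral_sum,
            (intro Bochner_Integration.integrable_sum noise(1); simp), intro sum.cong refl)+
      also have "\<dots> = 0"
        by (intro sum.neutral ballI) (simp add: noise(2))
      finally show "expectation N = 0" .
    qed
    have R: "integrable M R" "expectation R = 0"
      unfolding R_def using A_int by (auto simp: prob_space A_mean)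
    have "expectation ?lhs \<le> expectation ?rhs"
    proof (rule integral_mono)
      show "integrable M ?lhs"
        using N(1) R(1) by auto
      show "integrable M ?rhs"
        using del_int by auto
      show "?lhs \<omega> \<le> ?rhs \<omega>" if "\<omega> \<in> space M" for \<omega>
        unfolding target_def del_def N_def R_def
        by (rule uora_path.pathwise_utility_bound[OF path[OF that] region lam rstar_le T rbar_nonneg])
    qed
    moreover have "expectation ?lhs = real T * target - net.overhead"
      using N R by (simp add: prob_space)
    moreover have "expectation ?rhs = real T * (\<Sum>c\<in>UNIV. g c (rbar c) - g' c (rbar c) * rbar c
        + g' c (rbar c) * avg c T)"
      using del_int T
      by (simp add: prob_space avg_def sum_distrib_left distrib_left)
    ultimately show ?thesis
      using T by (simp add: field_simps)
  qed
  have "(\<lambda>T. target - net.overhead / real T) \<longlonglongrightarrow> target - 0"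
    by (intro tendsto_intros lim_const_over_n)
  moreover have "(\<lambda>T. \<Sum>c\<in>UNIV. g c (rbar c) - g' c (rbar c) * rbar c + g' c (rbar c) * avg c T)
      \<longlonglongrightarrow> (\<Sum>c\<in>UNIV. g c (rbar c) - g' c (rbar c) * rbar c + g' c (rbar c) * rbar c)"
    by (intro tendsto_intros avg_lim)
  ultimately have "target - 0
      \<le> (\<Sum>c\<in>UNIV. g c (rbar c) - g' c (rbar c) * rbar c + g' c (rbar c) * rbar c)"
    by (rule LIMSEQ_le) (use finite_horizon in \<open>auto intro!: exI[of _ 1]\<close>)
  then have limit: "target \<le> (\<Sum>c\<in>UNIV. g c (rbar c))"
    by simp
  have "net.slot_constant \<le> B1"
  proof -
    have "0 \<le> real CARD('c) * (w * (2 * \<delta>_max + \<epsilon>))"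
      using net.w_pos net.delta_pos eps by simp
    then show ?thesis
      unfolding B1 net.slot_constant_def by (simp add: algebra_simps)
  qed
  then have "net.slot_constant / V \<le> B1 / V"
    using V_pos by (simp add: divide_right_mono)
  moreover have "\<epsilon> * (\<Sum>c\<in>UNIV. m c) + \<epsilon> / 2 * (\<Sum>c\<in>UNIV. \<theta> c)
      \<le> 3 * \<epsilon> / 2 * (\<Sum>c\<in>UNIV. m c + \<theta> c)"
  proof -
    have "0 \<le> m c" for c
      using g'_bound[of 0 c] by simp
    then have "0 \<le> (\<Sum>c\<in>UNIV. m c)" "0 \<le> (\<Sum>c\<in>UNIV. \<theta> c)"
      using less_imp_le[OF theta_pos] by (simp_all add: sum_nonneg)
    then have "0 \<le> \<epsilon> / 2 * (\<Sum>c\<in>UNIV. m c)" "0 \<le> \<epsilon> * (\<Sum>c\<in>UNIV. \<theta> c)"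
      using eps by simp_all
    then show ?thesis
      by (simp add: sum.distrib algebra_simps)
  qed
  ultimately show ?thesis
    using limit unfolding target_def by linarith
qed

end
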